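(* There exists an absolute constant $C$ such that for every block subspace $Y\prec T$ and every $n\in\mathbb{N}$ there exist a block subspace $Z\prec Y$ and $d>0$ such that $Z\prec Y$ is $n$-stable at $d$ and $$(Cn)^{-1}\le d\le Cn^{-1}.$$
   Context: For finite sets $E,F\subseteq\mathbb{N}$ write $E<F$ (resp. $E\le F$) if $\max E<\min F$ (resp. $\max E\le\min F$) or if either set is empty. The Schreier classes are $S_0=\{\{n\}:n\in\mathbb{N}\}\cup\{\emptyset\}$ and $S_{k+1}=\{\bigcup_{p=1}^{\ell}E_p:\{\ell\}\le E_1<\cdots<E_\ell,\ E_p\in S_k \text{ for } 1\le p\le\ell\}$. A family of finite nonempty sets $(E_i)_{i=1}^\ell$ is $k$-admissible if $E_1<\cdots<E_\ell$ and $\{\min E_i\}_{i=1}^\ell\in S_k$. $c_{00}$ is the space of finitely supported real sequences, with unit vector basis $(e_i)$; for $x=\sum_i x(i)e_i$ put $Ex=\sum_{i\in E}x(i)e_i$. Tsirelson's space $T=T(S_1,2^{-1})$ is the completion of $c_{00}$ under the norm given implicitly by $\|x\|=\|x\|_\infty\vee\sup\{\frac12\sum_{i=1}^\ell\|E_ix\|:(E_i)_1^\ell \text{ is 1-admissible}\}$. An admissible tree is a finite tree of finite subsets of $\mathbb{N}$ (ordered by reverse inclusion), with a single set of level $0$, such that the successors (which have level one greater) of any set in the tree, if there are any, form a 1-admissible partition of that set, and every set of level $m+1$ is a successor of some set of level $m$. A set of the tree is terminal if it has no successors. For integers $j\ge0$, $n\ge1$ and $x\in T$, $$|x|_j^n=\sup\Big\{\sum_{i\in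 A}2^{-(j+nk(i))}\|E_ix\|_\infty\Big\},$$ the supremum being over all admissible trees all of whose terminal sets have levels in $\{j,j+n,j+2n,\ldots\}$, where $(E_i)_{i\in A}$ are the terminal sets of the tree and $E_i$ has level $j+nk(i)$, $k(i)\ge0$. Each $|\cdot|_j^n$ is an equivalent norm on $T$. $Y\prec T$ means that $Y$ is the closed linear span of an (infinite) block basis $(y_i)$ of $(e_i)$, and $Z\prec Y$ means that $Z$ is the closed linear span of an infinite block basis of $(y_i)$. $S_Z=\{z\in Z:\|z\|=1\}$ (Tsirelson norm). $K>1$ denotes a fixed absolute constant with the property (such a $K$ exists) that for all $Y\prec T$ and $n\in\mathbb{N}$ there exist $Z\prec Y$ and $d>0$ with $d\le|z|_j^n\le Kd$ for all $0\le j<n$ and $z\in S_Z$. A block subspace $Z$ is called $n$-stable at $d$ if $$d=\inf_{0\le j<n}\inf_{z\in S_Z}|z|_j^n\le\sup_{0\le j<n}\sup_{z\in S_Z}|z|_j^n\le Kd .$$ *)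

theory Defs
  imports "HOL-Analysis.Analysis"
begin

section \<open>Schreier families\<close>

text \<open>The positive integers are the index set throughout: \<open>0 :: nat\<close> belongs to no Schreier
  set, and sequences vanish at \<open>0\<close>.\<close>

definition set_less :: "nat set \<Rightarrow> nat set \<Rightarrow> bool" where
  "set_less E F \<longleftrightarrow> E = {} \<or> F = {} \<or> Max E < Min F"

definition set_le :: "nat set \<Rightarrow> nat set \<Rightarrow> bool" where
  "set_le E F \<longleftrightarrow> E = {} \<or> F = {} \<or> Max E \<le> Min F"

text \<open>A chain \<open>{l} \<le> E\<^sub>1 < \<dots> < E\<^sub>l\<close> is read pairwise; these relations are not transitive
  through empty sets.\<close>

primrec schreier :: "nat \<Rightarrow> nat set set" where
  "schreier 0 = insert {} {{n} | n. 1 \<le> n}"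
| "schreier (Suc k) = {\<Union>(set Es) | Es.
     sorted_wrt set_less Es \<and> (\<forall>E\<in>set Es. set_le {length Es} E \<and> E \<in> schreier k)}"

definition admissible :: "nat \<Rightarrow> nat set list \<Rightarrow> bool" where
  "admissible k Es \<longleftrightarrow> (\<forall>E\<in>set Es. finite E \<and> E \<noteq> {}) \<and> sorted_wrt set_less Es \<and>
     Min ` set Es \<in> schreier k"


section \<open>The Tsirelson norm on finitely supported sequences\<close>

definition c00 :: "(nat \<Rightarrow> real) set" where
  "c00 = {x. x 0 = 0 \<and> finite {i. x i \<noteq> 0}}"

definition restr :: "nat set \<Rightarrow> (nat \<Rightarrow> real) \<Rightarrow> nat \<Rightarrow> real" where
  "restr E x = (\<lambda>i. if i \<in> E then x i else 0)"

definition supn :: "(nat \<Rightarrow> real) \<Rightarrow> real" where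
  "supn x = (SUP i. \<bar>x i\<bar>)"

definition is_tsirelson_norm :: "((nat \<Rightarrow> real) \<Rightarrow> real) \<Rightarrow> bool" where
  "is_tsirelson_norm N \<longleftrightarrow>
     (\<forall>x\<in>c00. 0 \<le> N x \<and> (N x = 0 \<longleftrightarrow> x = (\<lambda>i. 0))) \<and>
     (\<forall>x\<in>c00. \<forall>y\<in>c00. N (\<lambda>i. x i + y i) \<le> N x + N y) \<and>
     (\<forall>x\<in>c00. \<forall>c. N (\<lambda>i. c * x i) = \<bar>c\<bar> * N x) \<and>
     (\<forall>x\<in>c00. N x = max (supn x)
        (SUP Es\<in>{Es. admissible 1 Es}. 1/2 * (\<Sum>E\<leftarrow>Es. N (restr E x))))"

text \<open>The value outside \<^term>\<open>c00\<close> is fixed only to make the norm unique as a function on all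
  sequences. Existence and uniqueness are established in \<open>ex1_tsirelson_norm\<close> below.\<close>

definition tsnorm :: "(nat \<Rightarrow> real) \<Rightarrow> real" where
  "tsnorm = (THE N. is_tsirelson_norm N \<and> (\<forall>x. x \<notin> c00 \<longrightarrow> N x = 0))"


subsection \<open>Existence and uniqueness\<close>

lemma c00_zero: "(\<lambda>i. 0) \<in> c00"
  by (simp add: c00_def)

lemma c00_add: "x \<in> c00 \<Longrightarrow> y \<in> c00 \<Longrightarrow> (\<lambda>i. x i + y i) \<in> c00"
  unfolding c00_def
  by (auto intro: finite_subset[of _ "{i. x i \<noteq> 0} \<union> {i. y i \<noteq> 0}"])

lemma c00_cmult: "x \<in> c00 \<Longrightarrow> (\<lambda>i. c * x i) \<in> c00"
  unfolding c00_def
  by (auto intro: finite_subset[of _ "{i. x i \<noteq> 0}"])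

lemma c00_diff: "x \<in> c00 \<Longrightarrow> y \<in> c00 \<Longrightarrow> (\<lambda>i. x i - y i) \<in> c00"
  using c00_add[of x "\<lambda>i. (-1) * y i"] c00_cmult[of y "-1"] by simp

lemma c00_restr: "x \<in> c00 \<Longrightarrow> restr E x \<in> c00"
  unfolding c00_def restr_def
  by (auto intro: finite_subset[of _ "{i. x i \<noteq> 0}"])

lemma c00_restr_finite: "x 0 = 0 \<Longrightarrow> finite E \<Longrightarrow> restr E x \<in> c00"
  unfolding c00_def restr_def by (auto intro: finite_subset[of _ E])

lemma bdd_c00: assumes "x \<in> c00" shows "bdd_above (range (\<lambda>i. \<bar>x i\<bar>))"
proof -
  have "finite (range (\<lambda>i. \<bar>x i\<bar>))"
    by (rule finite_subset[of _ "insert 0 ((\<lambda>i. \<bar>x i\<bar>) ` {i. x i \<noteq> 0})"])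
      (use assms in \<open>auto simp: c00_def\<close>)
  then show ?thesis by simp
qed

lemma supn_ge: "x \<in> c00 \<Longrightarrow> \<bar>x i\<bar> \<le> supn x"
  unfolding supn_def by (rule cSUP_upper) (auto simp: bdd_c00)

lemma supn_nonneg: "x \<in> c00 \<Longrightarrow> 0 \<le> supn x"
  using supn_ge[of x 0] by linarith

lemma supn_le: "(\<And>i. \<bar>x i\<bar> \<le> C) \<Longrightarrow> supn x \<le> C"
  unfolding supn_def by (rule cSUP_least) auto

lemma admissible_Nil: "admissible 1 []"
proof -
  have "{} \<in> schreier 1"
    by (auto intro!: exI[of _ "[]"])
  then show ?thesis by (simp add: admissible_def)
qed

lemma admissible_disjoint:
  assumes "admissible k Es"
  shows "distinct Es" and "\<And>E F. E \<in> set Es \<Longrightarrow> F \<in> set Es \<Longrightarrow> E \<noteq> F \<Longrightarrow> E \<inter> F = {}"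
proof -
  have s: "sorted_wrt set_less Es" and f: "\<And>E. E \<in> set Es \<Longrightarrow> finite E \<and> E \<noteq> {}"
    using assms by (auto simp: admissible_def)
  have d: "E \<inter> F = {}" if "E \<in> set Es" "F \<in> set Es" "set_less E F" for E F
  proof (rule ccontr)
    assume "E \<inter> F \<noteq> {}"
    then obtain i where i: "i \<in> E" "i \<in> F" by auto
    have "Max E < Min F" using that f by (auto simp: set_less_def)
    moreover have "i \<le> Max E" "Min F \<le> i" using i that f by auto
    ultimately show False by linarith
  qed
  have nth: "Es ! p \<inter> Es ! q = {}" if "p < q" "q < length Es" for p q
    using s that d[of "Es ! p" "Es ! q"] by (auto simp: sorted_wrt_iff_nth_less)
  show "distinct Es"
    unfolding distinct_conv_nth
  proof (intro allI impI)
    fix p q assume "p < length Es" "q < length Es" "p \<noteq> q"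
    then show "Es ! p \<noteq> Es ! q"
      using nth[of p q] nth[of q p] f[of "Es ! p"] f[of "Es ! q"]
      by (metis inf.idem linorder_neqE_nat nth_mem)
  qed
  show "E \<inter> F = {}" if "E \<in> set Es" "F \<in> set Es" "E \<noteq> F" for E F
    using that nth by (metis in_set_conv_nth inf_commute linorder_neqE_nat)
qed

lemma admissible_sum_list:
  "admissible k Es \<Longrightarrow> (\<Sum>E\<leftarrow>Es. f E) = (\<Sum>E\<in>set Es. f E)"
  using admissible_disjoint(1) by (simp add: sum_list_distinct_conv_sum_set)

text \<open>The norm is obtained as the supremum over a set of norming functionals.\<close>

inductive_set norming :: "(nat \<Rightarrow> real) set" where
  unit: "\<bar>c\<bar> \<le> 1 \<Longrightarrow> (\<lambda>k. if k = i then c else 0) \<in> norming"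
| step: "admissible 1 Es \<Longrightarrow> (\<And>E. E \<in> set Es \<Longrightarrow> f E \<in> norming) \<Longrightarrow>
    (\<And>E i. E \<in> set Es \<Longrightarrow> i \<notin> E \<Longrightarrow> f E i = 0) \<Longrightarrow>
    (\<lambda>i. 1/2 * (\<Sum>E\<leftarrow>Es. f E i)) \<in> norming"

definition pair :: "(nat \<Rightarrow> real) \<Rightarrow> (nat \<Rightarrow> real) \<Rightarrow> real" where
  "pair f x = (\<Sum>i\<in>{i. x i \<noteq> 0}. f i * x i)"

definition fnorm :: "(nat \<Rightarrow> real) \<Rightarrow> real" where
  "fnorm x = (if x \<in> c00 then SUP f\<in>norming. pair f x else 0)"

lemma pair_eq: "finite A \<Longrightarrow> {i. x i \<noteq> 0} \<subseteq> A \<Longrightarrow> pair f x = (\<Sum>i\<in>A. f i * x i)"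
  unfolding pair_def by (rule sum.mono_neutral_left) auto

lemma norming_le_1: "f \<in> norming \<Longrightarrow> \<bar>f i\<bar> \<le> 1"
proof (induction arbitrary: i rule: norming.induct)
  case (unit c j)
  then show ?case by auto
next
  case (step Es f)
  have "\<bar>\<Sum>E\<in>set Es. f E i\<bar> \<le> 1"
  proof (cases "\<exists>E\<in>set Es. i \<in> E")
    case True
    then obtain E where E: "E \<in> set Es" "i \<in> E" by auto
    have "(\<Sum>F\<in>set Es. f F i) = (\<Sum>F\<in>{E}. f F i)"
    proof (rule sum.mono_neutral_right)
      show "\<forall>F\<in>set Es - {E}. f F i = 0"
        using step.hyps(3) admissible_disjoint(2)[OF step.hyps(1) _ E(1)] E(2) by blast
    qed (use E in auto)
    then show ?thesis using step.IH[OF E(1)] by simp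
  next
    case False
    then show ?thesis using step.hyps(3) by simp
  qed
  then show ?case using step.hyps(1) by (simp add: admissible_sum_list abs_mult)
qed

lemma norming_restr: "f \<in> norming \<Longrightarrow> restr A f \<in> norming"
proof (induction rule: norming.induct)
  case (unit c i)
  have "restr A (\<lambda>k. if k = i then c else 0) = (\<lambda>k. if k = i then (if i \<in> A then c else 0) else 0)"
    by (auto simp: restr_def)
  then show ?case using norming.unit[of "if i \<in> A then c else 0" i] unit by (simp split: if_splits)
next
  case (step Es f)
  have "restr A (\<lambda>i. 1/2 * (\<Sum>E\<leftarrow>Es. f E i)) = (\<lambda>i. 1/2 * (\<Sum>E\<leftarrow>Es. restr A (f E) i))"
    by (auto simp: restr_def)
  moreover have "\<dots> \<in> norming"
    by (rule norming.step) (use step in \<open>auto simp: restr_def\<close>)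
  ultimately show ?case by simp
qed

lemma norming_uminus: "f \<in> norming \<Longrightarrow> (\<lambda>i. - f i) \<in> norming"
proof (induction rule: norming.induct)
  case (unit c i)
  have "(\<lambda>k. - (if k = i then c else 0)) = (\<lambda>k. if k = i then - c else 0)" by auto
  then show ?case using norming.unit[of "- c" i] unit by simp
next
  case (step Es f)
  have "(\<lambda>i. - (1/2 * (\<Sum>E\<leftarrow>Es. f E i))) = (\<lambda>i. 1/2 * (\<Sum>E\<leftarrow>Es. (\<lambda>i. - f E i) i))"
    using step.hyps(1) by (simp add: admissible_sum_list sum_negf)
  moreover have "\<dots> \<in> norming"
    by (rule norming.step) (use step in auto)
  ultimately show ?case by simp
qed

lemma norming_zero: "(\<lambda>i. 0) \<in> norming"
  using norming.unit[of 0 0] by simp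

lemma pair_add:
  assumes "x \<in> c00" "y \<in> c00"
  shows "pair f (\<lambda>i. x i + y i) = pair f x + pair f y"
proof -
  let ?A = "{i. x i \<noteq> 0} \<union> {i. y i \<noteq> 0}"
  have A: "finite ?A" using assms by (auto simp: c00_def)
  have "pair f (\<lambda>i. x i + y i) = (\<Sum>i\<in>?A. f i * (x i + y i))"
    by (rule pair_eq[OF A]) auto
  also have "\<dots> = (\<Sum>i\<in>?A. f i * x i) + (\<Sum>i\<in>?A. f i * y i)"
    by (simp add: sum.distrib algebra_simps)
  also have "\<dots> = pair f x + pair f y"
    using pair_eq[OF A, of x f] pair_eq[OF A, of y f] by auto
  finally show ?thesis .
qed

lemma pair_cmult: "pair f (\<lambda>i. c * x i) = c * pair f x"
proof (cases "c = 0")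
  case False
  then show ?thesis by (simp add: pair_def sum_distrib_left algebra_simps)
qed (simp add: pair_def)

lemma pair_uminus: "pair (\<lambda>i. - f i) x = - pair f x"
  by (simp add: pair_def sum_negf)

lemma pair_restr: assumes "x \<in> c00" shows "pair f (restr A x) = pair (restr A f) x"
proof -
  have "pair f (restr A x) = (\<Sum>i\<in>{i. x i \<noteq> 0}. f i * restr A x i)"
    by (rule pair_eq) (use assms in \<open>auto simp: c00_def restr_def\<close>)
  also have "\<dots> = pair (restr A f) x"
    unfolding pair_def by (rule sum.cong) (auto simp: restr_def)
  finally show ?thesis .
qed

lemma pair_le_l1: "f \<in> norming \<Longrightarrow> pair f x \<le> (\<Sum>i\<in>{i. x i \<noteq> 0}. \<bar>x i\<bar>)"
  unfolding pair_def
proof (rule sum_mono)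
  fix i assume "f \<in> norming"
  then have "\<bar>f i\<bar> * \<bar>x i\<bar> \<le> 1 * \<bar>x i\<bar>"
    by (intro mult_right_mono norming_le_1) auto
  then show "f i * x i \<le> \<bar>x i\<bar>" by (metis abs_le_D1 abs_mult mult_1)
qed

lemma bdd_pair: "bdd_above ((\<lambda>f. pair f x) ` norming)"
  using pair_le_l1 by (intro bdd_aboveI[of _ "\<Sum>i\<in>{i. x i \<noteq> 0}. \<bar>x i\<bar>"]) auto

lemma pair_le_fnorm: "x \<in> c00 \<Longrightarrow> f \<in> norming \<Longrightarrow> pair f x \<le> fnorm x"
  unfolding fnorm_def using cSUP_upper[OF _ bdd_pair] by simp

lemma fnorm_le: "x \<in> c00 \<Longrightarrow> (\<And>f. f \<in> norming \<Longrightarrow> pair f x \<le> C) \<Longrightarrow> fnorm x \<le> C"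
  unfolding fnorm_def using norming_zero by (auto intro!: cSUP_least)

lemma fnorm_ge_coord: assumes "x \<in> c00" shows "\<bar>x i\<bar> \<le> fnorm x"
proof -
  have "pair (\<lambda>k. if k = i then sgn (x i) else 0) x = \<bar>x i\<bar>"
  proof (cases "x i = 0")
    case True
    then show ?thesis unfolding pair_def by (auto intro!: sum.neutral)
  next
    case False
    have "pair (\<lambda>k. if k = i then sgn (x i) else 0) x =
        (\<Sum>k\<in>{k. x k \<noteq> 0}. if k = i then sgn (x i) * x i else 0)"
      unfolding pair_def by (rule sum.cong) auto
    also have "\<dots> = \<bar>x i\<bar>"
      using False assms by (simp add: c00_def sgn_if abs_if)
    finally show ?thesis .
  qed
  moreover have "(\<lambda>k. if k = i then sgn (x i) else 0) \<in> norming"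
    by (rule norming.unit) (auto simp: sgn_if)
  ultimately show ?thesis using pair_le_fnorm[OF assms] by metis
qed

lemma fnorm_nonneg: "x \<in> c00 \<Longrightarrow> 0 \<le> fnorm x"
  using fnorm_ge_coord[of x 0] by linarith

lemma fnorm_zero: "fnorm (\<lambda>i. 0) = 0"
proof (rule antisym)
  show "fnorm (\<lambda>i. 0) \<le> 0" by (rule fnorm_le) (auto simp: c00_zero pair_def)
qed (rule fnorm_nonneg[OF c00_zero])

lemma fnorm_triangle:
  "x \<in> c00 \<Longrightarrow> y \<in> c00 \<Longrightarrow> fnorm (\<lambda>i. x i + y i) \<le> fnorm x + fnorm y"
  by (rule fnorm_le) (auto simp: c00_add pair_add intro!: add_mono pair_le_fnorm)

lemma fnorm_cmult_le: assumes "x \<in> c00" shows "fnorm (\<lambda>i. c * x i) \<le> \<bar>c\<bar> * fnorm x"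
proof (rule fnorm_le)
  fix f assume f: "f \<in> norming"
  have "\<bar>pair f x\<bar> \<le> fnorm x"
    using pair_le_fnorm[OF assms f] pair_le_fnorm[OF assms norming_uminus[OF f]]
    by (simp add: pair_uminus)
  then have "\<bar>c\<bar> * \<bar>pair f x\<bar> \<le> \<bar>c\<bar> * fnorm x" by (rule mult_left_mono) auto
  then show "pair f (\<lambda>i. c * x i) \<le> \<bar>c\<bar> * fnorm x"
    by (metis abs_le_D1 abs_mult pair_cmult)
qed (rule c00_cmult[OF assms])

lemma fnorm_cmult: assumes "x \<in> c00" shows "fnorm (\<lambda>i. c * x i) = \<bar>c\<bar> * fnorm x"
proof (cases "c = 0")
  case True
  then show ?thesis by (simp add: fnorm_zero)
next
  case False
  have "fnorm x \<le> \<bar>1/c\<bar> * fnorm (\<lambda>i. c * x i)"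
    using fnorm_cmult_le[OF c00_cmult[OF assms, of c], of "1/c"] False by simp
  then have "\<bar>c\<bar> * fnorm x \<le> fnorm (\<lambda>i. c * x i)"
    using False by (simp add: field_simps)
  with fnorm_cmult_le[OF assms, of c] show ?thesis by simp
qed

lemma fnorm_restr_le: "x \<in> c00 \<Longrightarrow> fnorm (restr A x) \<le> fnorm x"
  by (rule fnorm_le) (auto simp: c00_restr pair_restr intro!: pair_le_fnorm norming_restr)

lemma fnorm_admissible:
  assumes x: "x \<in> c00" and Es: "admissible 1 Es"
  shows "1/2 * (\<Sum>E\<leftarrow>Es. fnorm (restr E x)) \<le> fnorm x"
proof (rule field_le_epsilon)
  fix e :: real assume e: "0 < e"
  define d where "d = e / (real (card (set Es)) + 1)"
  have d: "0 < d" "real (card (set Es)) * d \<le> e"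
    using e by (auto simp: d_def field_simps)
  have "\<exists>f\<in>norming. fnorm (restr E x) - d \<le> pair f (restr E x)" for E
  proof (rule ccontr)
    assume "\<not> ?thesis"
    then have "fnorm (restr E x) \<le> fnorm (restr E x) - d"
      by (intro fnorm_le) (auto simp: c00_restr[OF x] not_le intro: less_imp_le)
    then show False using d by simp
  qed
  then obtain f where f: "\<And>E. f E \<in> norming" "\<And>E. fnorm (restr E x) - d \<le> pair (f E) (restr E x)"
    by metis
  let ?g = "\<lambda>i. 1/2 * (\<Sum>E\<leftarrow>Es. restr E (f E) i)"
  have g: "?g \<in> norming"
    by (rule norming.step[OF Es]) (auto simp: norming_restr f, auto simp: restr_def)
  have "1/2 * (\<Sum>E\<leftarrow>Es. fnorm (restr E x)) - e \<le> 1/2 * (\<Sum>E\<in>set Es. fnorm (restr E x) - d)"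
    using d e by (simp add: admissible_sum_list[OF Es] sum_subtractf)
  also have "\<dots> \<le> 1/2 * (\<Sum>E\<in>set Es. pair (f E) (restr E x))"
    by (simp add: sum_mono f(2))
  also have "\<dots> = 1/2 * (\<Sum>E\<in>set Es. pair (restr E (f E)) x)"
    by (simp add: pair_restr x)
  also have "\<dots> = pair ?g x"
    unfolding pair_def admissible_sum_list[OF Es]
    by (simp add: sum_distrib_left sum_distrib_right sum_divide_distrib)
       (subst sum.swap, simp)
  also have "\<dots> \<le> fnorm x" by (rule pair_le_fnorm[OF x g])
  finally show "1/2 * (\<Sum>E\<leftarrow>Es. fnorm (restr E x)) \<le> fnorm x + e" by simp
qed

lemma fnorm_equation:
  assumes x: "x \<in> c00"
  shows "fnorm x = max (supn x)
    (SUP Es\<in>{Es. admissible 1 Es}. 1/2 * (\<Sum>E\<leftarrow>Es. fnorm (restr E x)))"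
    (is "_ = max _ (Sup (?S ` ?A))")
proof (rule antisym)
  have bdd: "bdd_above (?S ` ?A)"
    using fnorm_admissible[OF x] by (intro bdd_aboveI[of _ "fnorm x"]) auto
  have "Sup (?S ` ?A) \<le> fnorm x"
    using fnorm_admissible[OF x] admissible_Nil by (intro cSUP_least) auto
  moreover have "supn x \<le> fnorm x" by (rule supn_le) (rule fnorm_ge_coord[OF x])
  ultimately show "max (supn x) (Sup (?S ` ?A)) \<le> fnorm x" by simp
  show "fnorm x \<le> max (supn x) (Sup (?S ` ?A))"
  proof (rule fnorm_le[OF x])
    fix g assume "g \<in> norming"
    then show "pair g x \<le> max (supn x) (Sup (?S ` ?A))"
    proof cases
      case (unit c i)
      have "pair g x \<le> \<bar>x i\<bar>"
      proof (cases "x i = 0")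
        case True
        then have "pair g x = 0" unfolding pair_def unit by (intro sum.neutral) auto
        then show ?thesis by simp
      next
        case False
        have "pair g x = (\<Sum>k\<in>{k. x k \<noteq> 0}. if k = i then c * x i else 0)"
          unfolding pair_def unit by (rule sum.cong) auto
        also have "\<dots> = c * x i" using False x by (simp add: c00_def)
        also have "\<dots> \<le> \<bar>c\<bar> * \<bar>x i\<bar>" by (metis abs_ge_self abs_mult)
        also have "\<dots> \<le> 1 * \<bar>x i\<bar>" using unit by (intro mult_right_mono) auto
        finally show ?thesis by simp
      qed
      also have "\<dots> \<le> supn x" by (rule supn_ge[OF x])
      finally show ?thesis by simp
    next
      case (step Es f)
      have *: "pair (f E) x \<le> fnorm (restr E x)" if "E \<in> set Es" for E
      proof -
        have "restr E (f E) = f E" using step(4)[OF that] by (auto simp: restr_def)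
        then have "pair (f E) x = pair (f E) (restr E x)" by (simp add: pair_restr x)
        also have "\<dots> \<le> fnorm (restr E x)"
          by (rule pair_le_fnorm[OF c00_restr[OF x] step(3)[OF that]])
        finally show ?thesis .
      qed
      have "pair g x = 1/2 * (\<Sum>E\<in>set Es. pair (f E) x)"
        unfolding pair_def step(1) admissible_sum_list[OF step(2)]
        by (simp add: sum_distrib_left sum_distrib_right sum_divide_distrib)
           (subst sum.swap, simp)
      also have "\<dots> \<le> ?S Es"
        using * by (simp add: admissible_sum_list[OF step(2)] sum_mono)
      also have "\<dots> \<le> Sup (?S ` ?A)"
        by (rule cSUP_upper[OF _ bdd]) (use step in simp)
      finally show ?thesis by simp
    qed
  qed
qed

lemma is_tsirelson_norm_fnorm: "is_tsirelson_norm fnorm"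
  unfolding is_tsirelson_norm_def
proof (intro conjI ballI allI)
  fix x assume x: "x \<in> c00"
  show "(fnorm x = 0) = (x = (\<lambda>i. 0))"
  proof
    assume "fnorm x = 0"
    then show "x = (\<lambda>i. 0)" using fnorm_ge_coord[OF x] by (auto intro!: ext)
  qed (simp add: fnorm_zero)
qed (rule fnorm_nonneg fnorm_triangle fnorm_cmult fnorm_equation; assumption)+

lemma is_tsirelson_norm_bdd:
  assumes N: "is_tsirelson_norm N" and x: "x \<in> c00"
  shows "bdd_above ((\<lambda>Es. 1/2 * (\<Sum>E\<leftarrow>Es. N (restr E x))) ` {Es. admissible 1 Es})"
proof -
  let ?e = "\<lambda>i. restr {i} x" and ?X = "{i. x i \<noteq> 0}"
  have X: "finite ?X" and x0: "x 0 = 0" using x by (auto simp: c00_def)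
  have nn: "0 \<le> N y" if "y \<in> c00" for y using N that by (auto simp: is_tsirelson_norm_def)
  have N0: "N (\<lambda>i. 0) = 0" using N c00_zero unfolding is_tsirelson_norm_def by blast
  have tri: "N (\<lambda>i. u i + v i) \<le> N u + N v" if "u \<in> c00" "v \<in> c00" for u v
    using N that by (auto simp: is_tsirelson_norm_def)
  have fin: "N (restr A x) \<le> (\<Sum>i\<in>A. N (?e i))" if "finite A" for A
    using that
  proof induction
    case empty
    then show ?case by (simp add: restr_def N0)
  next
    case (insert i A)
    have "restr (insert i A) x = (\<lambda>k. ?e i k + restr A x k)"
      using insert.hyps by (auto simp: restr_def fun_eq_iff)
    then have "N (restr (insert i A) x) \<le> N (?e i) + N (restr A x)"
      using tri[OF c00_restr[OF x] c00_restr[OF x]] by metis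
    then show ?case using insert by simp
  qed
  have le: "N (restr E x) \<le> (\<Sum>i\<in>E \<inter> ?X. N (?e i))" for E
  proof -
    have "restr E x = restr (E \<inter> ?X) x" by (auto simp: restr_def)
    then show ?thesis using fin[of "E \<inter> ?X"] X by simp
  qed
  have "(\<Sum>E\<leftarrow>Es. N (restr E x)) \<le> (\<Sum>i\<in>?X. N (?e i))" if Es: "admissible 1 Es" for Es
  proof -
    have "(\<Sum>E\<leftarrow>Es. N (restr E x)) \<le> (\<Sum>E\<in>set Es. \<Sum>i\<in>E \<inter> ?X. N (?e i))"
      unfolding admissible_sum_list[OF Es] by (rule sum_mono) (rule le)
    also have "\<dots> = (\<Sum>i\<in>(\<Union>E\<in>set Es. E \<inter> ?X). N (?e i))"
      using X admissible_disjoint(2)[OF Es] by (intro sum.UNION_disjoint[symmetric]) auto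
    also have "\<dots> \<le> (\<Sum>i\<in>?X. N (?e i))"
      using X nn[OF c00_restr[OF x]] by (intro sum_mono2) auto
    finally show ?thesis .
  qed
  then show ?thesis
    by (intro bdd_aboveI[of _ "1/2 * (\<Sum>i\<in>?X. N (?e i))"]) auto
qed

lemma is_tsirelson_norm_le:
  assumes N: "is_tsirelson_norm N" and N': "is_tsirelson_norm N'" and "x \<in> c00"
  shows "N x \<le> N' x"
  using \<open>x \<in> c00\<close>
proof (induction "card {i. x i \<noteq> 0}" arbitrary: x rule: less_induct)
  case less
  note x = \<open>x \<in> c00\<close>
  let ?X = "{i. x i \<noteq> 0}"
  have X: "finite ?X" using x by (auto simp: c00_def)
  have N0: "N (\<lambda>i. 0) = 0" using N c00_zero unfolding is_tsirelson_norm_def by blast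
  have nn: "0 \<le> N x" "0 \<le> N' x" using N N' x by (auto simp: is_tsirelson_norm_def)
  let ?S = "\<lambda>N Es. 1/2 * (\<Sum>E\<leftarrow>Es. N (restr E x) :: real)"
  have eq: "N x = max (supn x) (SUP Es\<in>{Es. admissible 1 Es}. ?S N Es)"
    using N x unfolding is_tsirelson_norm_def by blast
  have eq': "N' x = max (supn x) (SUP Es\<in>{Es. admissible 1 Es}. ?S N' Es)"
    using N' x unfolding is_tsirelson_norm_def by blast
  have "?S N Es \<le> max (N x / 2) (N' x)" if Es: "admissible 1 Es" for Es
  proof (cases "\<exists>E\<in>set Es. ?X \<subseteq> E")
    case True
    then obtain E where E: "E \<in> set Es" "?X \<subseteq> E" by auto
    have "(\<Sum>F\<in>set Es. N (restr F x)) = (\<Sum>F\<in>{E}. N (restr F x))"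
    proof (rule sum.mono_neutral_right)
      show "\<forall>F\<in>set Es - {E}. N (restr F x) = 0"
      proof
        fix F assume "F \<in> set Es - {E}"
        then have "F \<inter> E = {}" using admissible_disjoint(2)[OF Es _ E(1)] by blast
        then have "restr F x = (\<lambda>i. 0)" using E(2) by (fastforce simp: restr_def)
        then show "N (restr F x) = 0" using N0 by simp
      qed
    qed (use E in auto)
    moreover have "restr E x = x" using E(2) by (fastforce simp: restr_def)
    ultimately show ?thesis by (simp add: admissible_sum_list[OF Es])
  next
    case False
    have "N (restr E x) \<le> N' (restr E x)" if "E \<in> set Es" for E
    proof (rule less.hyps)
      have "{i. restr E x i \<noteq> 0} \<subset> ?X" using False that by (auto simp: restr_def)
      then show "card {i. restr E x i \<noteq> 0} < card ?X" by (rule psubset_card_mono[OF X])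
    qed (rule c00_restr[OF x])
    then have "?S N Es \<le> ?S N' Es"
      by (simp add: admissible_sum_list[OF Es] sum_mono)
    also have "\<dots> \<le> (SUP Es\<in>{Es. admissible 1 Es}. ?S N' Es)"
      by (rule cSUP_upper[OF _ is_tsirelson_norm_bdd[OF N' x]]) (use Es in simp)
    also have "\<dots> \<le> N' x" unfolding eq' by simp
    finally show ?thesis by simp
  qed
  then have "(SUP Es\<in>{Es. admissible 1 Es}. ?S N Es) \<le> max (N x / 2) (N' x)"
    using admissible_Nil by (intro cSUP_least) auto
  moreover have "supn x \<le> N' x" unfolding eq' by simp
  ultimately have "N x \<le> max (N x / 2) (N' x)" using eq by linarith
  then show ?case using nn by linarith
qed

theorem ex1_tsirelson_norm: "\<exists>!N. is_tsirelson_norm N \<and> (\<forall>x. x \<notin> c00 \<longrightarrow> N x = 0)"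
proof (rule ex1I)
  show "is_tsirelson_norm fnorm \<and> (\<forall>x. x \<notin> c00 \<longrightarrow> fnorm x = 0)"
    using is_tsirelson_norm_fnorm by (simp add: fnorm_def)
  fix N assume N: "is_tsirelson_norm N \<and> (\<forall>x. x \<notin> c00 \<longrightarrow> N x = 0)"
  show "N = fnorm"
  proof
    fix x show "N x = fnorm x"
      using N is_tsirelson_norm_le[of N fnorm x] is_tsirelson_norm_le[of fnorm N x]
        is_tsirelson_norm_fnorm by (cases "x \<in> c00") (auto simp: fnorm_def intro: antisym)
  qed
qed

lemma is_tsirelson_norm_tsnorm: "is_tsirelson_norm tsnorm"
  and tsnorm_outside: "x \<notin> c00 \<Longrightarrow> tsnorm x = 0"
  using theI'[OF ex1_tsirelson_norm] unfolding tsnorm_def by blast+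

lemma tsnorm_fnorm: "tsnorm = fnorm"
  using ex1_tsirelson_norm is_tsirelson_norm_tsnorm tsnorm_outside is_tsirelson_norm_fnorm
  by (metis fnorm_def)

lemmas tsnorm_equation = fnorm_equation[folded tsnorm_fnorm]
lemmas tsnorm_admissible = fnorm_admissible[folded tsnorm_fnorm]
lemmas tsnorm_ge_coord = fnorm_ge_coord[folded tsnorm_fnorm]
lemmas tsnorm_nonneg = fnorm_nonneg[folded tsnorm_fnorm]
lemmas tsnorm_zero = fnorm_zero[folded tsnorm_fnorm]
lemmas tsnorm_triangle = fnorm_triangle[folded tsnorm_fnorm]
lemmas tsnorm_cmult = fnorm_cmult[folded tsnorm_fnorm]
lemmas tsnorm_restr_le = fnorm_restr_le[folded tsnorm_fnorm]


section \<open>Tsirelson's space\<close>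

lemma tsnorm_le_l1: "x \<in> c00 \<Longrightarrow> finite A \<Longrightarrow> {i. x i \<noteq> 0} \<subseteq> A \<Longrightarrow> tsnorm x \<le> (\<Sum>i\<in>A. \<bar>x i\<bar>)"
proof -
  assume x: "x \<in> c00" and A: "finite A" "{i. x i \<noteq> 0} \<subseteq> A"
  have "tsnorm x \<le> (\<Sum>i\<in>{i. x i \<noteq> 0}. \<bar>x i\<bar>)"
    unfolding tsnorm_fnorm by (rule fnorm_le[OF x]) (rule pair_le_l1)
  also have "\<dots> \<le> (\<Sum>i\<in>A. \<bar>x i\<bar>)" using A by (intro sum_mono2) auto
  finally show ?thesis .
qed

lemma tsnorm_minus: "x \<in> c00 \<Longrightarrow> tsnorm (\<lambda>i. - x i) = tsnorm x"
  using tsnorm_cmult[of x "-1"] by simp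

lemma tsnorm_diff_le: "x \<in> c00 \<Longrightarrow> y \<in> c00 \<Longrightarrow> \<bar>tsnorm x - tsnorm y\<bar> \<le> tsnorm (\<lambda>i. x i - y i)"
  using tsnorm_triangle[OF c00_diff[of x y], of y] tsnorm_triangle[OF c00_diff[of y x], of x]
    tsnorm_minus[OF c00_diff[of x y]] by (simp add: abs_le_iff)

lemma tsnorm_diff_triangle:
  assumes "x \<in> c00" "y \<in> c00"
  shows "tsnorm (\<lambda>i. x i - y i) \<le> tsnorm x + tsnorm y"
  using tsnorm_triangle[OF assms(1) c00_cmult[OF assms(2), of "-1"]] tsnorm_minus[OF assms(2)]
  by simp

text \<open>The initial segments of \<open>x\<close> form a Cauchy sequence for \<^term>\<open>tsnorm\<close>.\<close>

definition ts_cauchy :: "(nat \<Rightarrow> real) \<Rightarrow> bool" where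
  "ts_cauchy x \<longleftrightarrow> (\<forall>e>0. \<exists>M. \<forall>m\<ge>M. \<forall>n\<ge>M. tsnorm (\<lambda>i. restr {..m} x i - restr {..n} x i) < e)"

lemma ts_cauchy_add:
  assumes x: "x 0 = 0" "ts_cauchy x" and y: "y 0 = 0" "ts_cauchy y"
  shows "ts_cauchy (\<lambda>i. x i + y i)"
  unfolding ts_cauchy_def
proof (intro allI impI)
  fix e :: real assume "0 < e"
  then have "0 < e/2" by simp
  then obtain M1 M2 where
    M1: "\<And>m n. M1 \<le> m \<Longrightarrow> M1 \<le> n \<Longrightarrow> tsnorm (\<lambda>i. restr {..m} x i - restr {..n} x i) < e/2" and
    M2: "\<And>m n. M2 \<le> m \<Longrightarrow> M2 \<le> n \<Longrightarrow> tsnorm (\<lambda>i. restr {..m} y i - restr {..n} y i) < e/2"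
    using x(2) y(2) unfolding ts_cauchy_def by meson
  have "tsnorm (\<lambda>i. restr {..m} (\<lambda>i. x i + y i) i - restr {..n} (\<lambda>i. x i + y i) i) < e"
    if "max M1 M2 \<le> m" "max M1 M2 \<le> n" for m n
  proof -
    have eq: "(\<lambda>i. restr {..m} (\<lambda>i. x i + y i) i - restr {..n} (\<lambda>i. x i + y i) i) =
      (\<lambda>i. (restr {..m} x i - restr {..n} x i) + (restr {..m} y i - restr {..n} y i))"
      by (auto simp: restr_def)
    have "tsnorm (\<lambda>i. restr {..m} (\<lambda>i. x i + y i) i - restr {..n} (\<lambda>i. x i + y i) i) \<le>
        tsnorm (\<lambda>i. restr {..m} x i - restr {..n} x i) +
        tsnorm (\<lambda>i. restr {..m} y i - restr {..n} y i)"
      unfolding eq using x y by (intro tsnorm_triangle c00_diff c00_restr_finite) auto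
    also have "\<dots> < e/2 + e/2"
      using that by (intro add_strict_mono M1 M2) simp_all
    also have "\<dots> = e" by simp
    finally show ?thesis .
  qed
  then show "\<exists>M. \<forall>m\<ge>M. \<forall>n\<ge>M.
    tsnorm (\<lambda>i. restr {..m} (\<lambda>i. x i + y i) i - restr {..n} (\<lambda>i. x i + y i) i) < e" by blast
qed

lemma ts_cauchy_cmult:
  assumes x: "x 0 = 0" "ts_cauchy x"
  shows "ts_cauchy (\<lambda>i. c * x i)"
  unfolding ts_cauchy_def
proof (intro allI impI)
  fix e :: real assume "0 < e"
  then have "0 < e / (\<bar>c\<bar> + 1)" by simp
  then obtain M where
    M: "\<And>m n. M \<le> m \<Longrightarrow> M \<le> n \<Longrightarrow> tsnorm (\<lambda>i. restr {..m} x i - restr {..n} x i) < e / (\<bar>c\<bar> + 1)"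
    using x(2) unfolding ts_cauchy_def by meson
  have "tsnorm (\<lambda>i. restr {..m} (\<lambda>i. c * x i) i - restr {..n} (\<lambda>i. c * x i) i) < e"
    if "M \<le> m" "M \<le> n" for m n
  proof -
    let ?z = "\<lambda>i. restr {..m} x i - restr {..n} x i"
    have z: "?z \<in> c00" using x by (intro c00_diff c00_restr_finite) auto
    have "(\<lambda>i. restr {..m} (\<lambda>i. c * x i) i - restr {..n} (\<lambda>i. c * x i) i) = (\<lambda>i. c * ?z i)"
      by (auto simp: restr_def)
    then have "tsnorm (\<lambda>i. restr {..m} (\<lambda>i. c * x i) i - restr {..n} (\<lambda>i. c * x i) i) =
        \<bar>c\<bar> * tsnorm ?z" using tsnorm_cmult[OF z] by simp
    also have "\<dots> \<le> (\<bar>c\<bar> + 1) * tsnorm ?z"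
      by (intro mult_right_mono tsnorm_nonneg[OF z]) auto
    also have "\<dots> < e" using M[OF that] by (simp add: field_simps)
    finally show ?thesis .
  qed
  then show "\<exists>M. \<forall>m\<ge>M. \<forall>n\<ge>M.
    tsnorm (\<lambda>i. restr {..m} (\<lambda>i. c * x i) i - restr {..n} (\<lambda>i. c * x i) i) < e" by blast
qed

lemma ts_cauchy_c00: assumes "x \<in> c00" shows "ts_cauchy x"
proof -
  obtain M where M: "\<And>i. x i \<noteq> 0 \<Longrightarrow> i \<le> M"
    using assms by (auto simp: c00_def finite_nat_set_iff_bounded_le)
  have "tsnorm (\<lambda>i. restr {..m} x i - restr {..n} x i) = 0" if "M \<le> m" "M \<le> n" for m n
  proof -
    have "(\<lambda>i. restr {..m} x i - restr {..n} x i) = (\<lambda>i. 0)"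
    proof
      fix i show "restr {..m} x i - restr {..n} x i = 0"
        using M[of i] that by (cases "x i = 0") (auto simp: restr_def)
    qed
    then show ?thesis by (simp add: tsnorm_zero)
  qed
  then have "\<forall>m\<ge>M. \<forall>n\<ge>M. tsnorm (\<lambda>i. restr {..m} x i - restr {..n} x i) < e" if "0 < e" for e
    using that by simp
  then show ?thesis unfolding ts_cauchy_def by blast
qed

text \<open>The completion of \<^term>\<open>c00\<close> is realised as a space of sequences: the unit vectors form a
  Schauder basis, so the elements of the completion are the sequences with Cauchy initial segments.
  The instance of \<^class>\<open>banach\<close>, \<open>norm_of_c00\<close> and \<open>closure_span_unit_vec\<close> below say that
  this is indeed the completion.\<close>

typedef tsirelson = "{x :: nat \<Rightarrow> real. x 0 = 0 \<and> ts_cauchy x}"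
  morphisms coord Abs_tsirelson
  by (rule exI[of _ "\<lambda>i. 0"]) (simp add: ts_cauchy_c00 c00_zero)

lemma coord_0 [simp]: "coord x 0 = 0" and ts_cauchy_coord: "ts_cauchy (coord x)"
  using coord[of x] by auto

lemma coord_Abs: "x 0 = 0 \<Longrightarrow> ts_cauchy x \<Longrightarrow> coord (Abs_tsirelson x) = x"
  by (simp add: Abs_tsirelson_inverse)

lemma c00_restr_coord: "finite E \<Longrightarrow> restr E (coord x) \<in> c00"
  by (rule c00_restr_finite) auto

instantiation tsirelson :: real_normed_vector
begin

definition "0 = Abs_tsirelson (\<lambda>i. 0)"
definition "x + y = Abs_tsirelson (\<lambda>i. coord x i + coord y i)"
definition "- x = Abs_tsirelson (\<lambda>i. - coord x i)"
definition "x - y = Abs_tsirelson (\<lambda>i. coord x i - coord y i)"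
definition "c *\<^sub>R x = Abs_tsirelson (\<lambda>i. c * coord x i)"
definition norm_tsirelson :: "tsirelson \<Rightarrow> real" where
  "norm_tsirelson x = lim (\<lambda>n. tsnorm (restr {..n} (coord x)))"
definition "sgn x = inverse (norm x) *\<^sub>R x" for x :: tsirelson
definition "dist x y = norm (x - y)" for x y :: tsirelson
definition [code del]:
  "(uniformity :: (tsirelson \<times> tsirelson) filter) = (INF e\<in>{0 <..}. principal {(x, y). dist x y < e})"
definition [code del]:
  "open U = (\<forall>x\<in>U. eventually (\<lambda>(x', y). x' = x \<longrightarrow> y \<in> U) uniformity)" for U :: "tsirelson set"

lemma coord_zero [simp]: "coord 0 = (\<lambda>i. 0)"
  by (simp add: zero_tsirelson_def coord_Abs ts_cauchy_c00 c00_zero)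

lemma coord_add [simp]: "coord (x + y) = (\<lambda>i. coord x i + coord y i)"
  by (simp add: plus_tsirelson_def coord_Abs ts_cauchy_add ts_cauchy_coord)

lemma coord_scaleR [simp]: "coord (c *\<^sub>R x) = (\<lambda>i. c * coord x i)"
  by (simp add: scaleR_tsirelson_def coord_Abs ts_cauchy_cmult ts_cauchy_coord)

lemma coord_minus [simp]: "coord (- x) = (\<lambda>i. - coord x i)"
  using ts_cauchy_cmult[of "coord x" "-1"]
  by (simp add: uminus_tsirelson_def coord_Abs ts_cauchy_coord)

lemma coord_diff [simp]: "coord (x - y) = (\<lambda>i. coord x i - coord y i)"
proof -
  have "ts_cauchy (\<lambda>i. coord x i + coord (- y) i)"
    by (intro ts_cauchy_add ts_cauchy_coord) (rule coord_0)+
  then have "ts_cauchy (\<lambda>i. coord x i - coord y i)" by simp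
  then show ?thesis by (simp add: minus_tsirelson_def coord_Abs)
qed

lemma norm_LIMSEQ: "(\<lambda>n. tsnorm (restr {..n} (coord x))) \<longlonglongrightarrow> norm x"
proof -
  have "Cauchy (\<lambda>n. tsnorm (restr {..n} (coord x)))"
  proof (rule CauchyI)
    fix e :: real assume "0 < e"
    then obtain M where M: "\<forall>m\<ge>M. \<forall>n\<ge>M.
        tsnorm (\<lambda>i. restr {..m} (coord x) i - restr {..n} (coord x) i) < e"
      using ts_cauchy_coord[of x] unfolding ts_cauchy_def by blast
    have "norm (tsnorm (restr {..m} (coord x)) - tsnorm (restr {..n} (coord x))) < e"
      if "M \<le> m" "M \<le> n" for m n
      using tsnorm_diff_le[of "restr {..m} (coord x)" "restr {..n} (coord x)"] M that
      by (force simp: c00_restr_coord intro: le_less_trans)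
    then show "\<exists>M. \<forall>m\<ge>M. \<forall>n\<ge>M.
        norm (tsnorm (restr {..m} (coord x)) - tsnorm (restr {..n} (coord x))) < e" by blast
  qed
  then show ?thesis
    unfolding norm_tsirelson_def using Cauchy_convergent convergent_LIMSEQ_iff by blast
qed

lemma tsnorm_restr_le_norm: assumes "finite E" shows "tsnorm (restr E (coord x)) \<le> norm x"
proof (rule LIMSEQ_le_const[OF norm_LIMSEQ])
  obtain M where M: "\<And>i. i \<in> E \<Longrightarrow> i \<le> M"
    using assms by (auto simp: finite_nat_set_iff_bounded_le)
  have "tsnorm (restr E (coord x)) \<le> tsnorm (restr {..n} (coord x))" if "M \<le> n" for n
  proof -
    have "restr E (coord x) = restr E (restr {..n} (coord x))"
      using M that by (force simp: restr_def)
    then show ?thesis using tsnorm_restr_le[OF c00_restr_coord, of "{..n}" E x] by simp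
  qed
  then show "\<exists>N. \<forall>n\<ge>N. tsnorm (restr E (coord x)) \<le> tsnorm (restr {..n} (coord x))" by blast
qed

lemma coord_le_norm: "\<bar>coord x i\<bar> \<le> norm x"
proof -
  have "\<bar>restr {i} (coord x) i\<bar> \<le> tsnorm (restr {i} (coord x))"
    by (rule tsnorm_ge_coord) (simp add: c00_restr_coord)
  also have "\<dots> \<le> norm x" by (rule tsnorm_restr_le_norm) simp
  finally show ?thesis by (simp add: restr_def)
qed

lemma norm_le_tsirelson: "(\<And>n. tsnorm (restr {..n} (coord x)) \<le> C) \<Longrightarrow> norm x \<le> C"
  using norm_LIMSEQ by (rule LIMSEQ_le_const2) auto

instance
proof
  fix x y z :: tsirelson and a b :: real
  show "x + y + z = x + (y + z)" "x + y = y + x" "0 + x = x" "- x + x = 0" "x - y = x + - y"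
    "a *\<^sub>R (x + y) = a *\<^sub>R x + a *\<^sub>R y" "(a + b) *\<^sub>R x = a *\<^sub>R x + b *\<^sub>R x"
    "a *\<^sub>R b *\<^sub>R x = (a * b) *\<^sub>R x" "1 *\<^sub>R x = x"
    by (simp_all add: coord_inject[symmetric] algebra_simps)
  show "norm x = 0 \<longleftrightarrow> x = 0"
  proof
    assume "norm x = 0"
    then have "coord x i = 0" for i using coord_le_norm[of x i] by simp
    then show "x = 0" by (auto simp: coord_inject[symmetric])
  next
    assume "x = 0"
    moreover have "restr A (\<lambda>i. 0) = (\<lambda>i. 0)" for A by (auto simp: restr_def)
    ultimately show "norm x = 0" by (simp add: norm_tsirelson_def tsnorm_zero)
  qed
  show "norm (x + y) \<le> norm x + norm y"
  proof (rule norm_le_tsirelson)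
    fix n
    have "restr {..n} (coord (x + y)) = (\<lambda>i. restr {..n} (coord x) i + restr {..n} (coord y) i)"
      by (auto simp: restr_def)
    then have "tsnorm (restr {..n} (coord (x + y))) \<le>
        tsnorm (restr {..n} (coord x)) + tsnorm (restr {..n} (coord y))"
      using tsnorm_triangle[of "restr {..n} (coord x)" "restr {..n} (coord y)"]
      by (simp add: c00_restr_coord)
    also have "\<dots> \<le> norm x + norm y" by (intro add_mono tsnorm_restr_le_norm) auto
    finally show "tsnorm (restr {..n} (coord (x + y))) \<le> norm x + norm y" .
  qed
  have "restr {..n} (coord (a *\<^sub>R x)) = (\<lambda>i. a * restr {..n} (coord x) i)" for n
    by (auto simp: restr_def)
  then have "(\<lambda>n. \<bar>a\<bar> * tsnorm (restr {..n} (coord x))) \<longlonglongrightarrow> norm (a *\<^sub>R x)"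
    using norm_LIMSEQ[of "a *\<^sub>R x"] by (simp add: tsnorm_cmult c00_restr_coord)
  then show "norm (a *\<^sub>R x) = \<bar>a\<bar> * norm x"
    using LIMSEQ_unique tendsto_mult_left[OF norm_LIMSEQ] by blast
qed (rule sgn_tsirelson_def dist_tsirelson_def uniformity_tsirelson_def open_tsirelson_def)+

end

instance tsirelson :: banach
proof
  fix X :: "nat \<Rightarrow> tsirelson" assume X: "Cauchy X"
  define x where "x i = lim (\<lambda>k. coord (X k) i)" for i
  have lim: "(\<lambda>k. coord (X k) i) \<longlonglongrightarrow> x i" for i
  proof -
    have "Cauchy (\<lambda>k. coord (X k) i)"
    proof (rule CauchyI)
      fix e :: real assume "0 < e"
      then obtain M where M: "\<forall>m\<ge>M. \<forall>n\<ge>M. norm (X m - X n) < e" using CauchyD[OF X] by blast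
      have "norm (coord (X m) i - coord (X n) i) < e" if "M \<le> m" "M \<le> n" for m n
        using coord_le_norm[of "X m - X n" i] M that by (force intro: le_less_trans)
      then show "\<exists>M. \<forall>m\<ge>M. \<forall>n\<ge>M. norm (coord (X m) i - coord (X n) i) < e" by blast
    qed
    then show ?thesis unfolding x_def using Cauchy_convergent convergent_LIMSEQ_iff by blast
  qed
  have x0: "x 0 = 0" using LIMSEQ_unique[OF lim[of 0]] by simp
  have close: "\<exists>K. \<forall>k\<ge>K. \<forall>E. finite E \<longrightarrow> tsnorm (restr E (\<lambda>i. coord (X k) i - x i)) \<le> e"
    if "0 < e" for e
  proof -
    from CauchyD[OF X that]
    obtain K where K: "\<forall>m\<ge>K. \<forall>n\<ge>K. norm (X m - X n) < e" by blast
    have "tsnorm (restr E (\<lambda>i. coord (X k) i - x i)) \<le> e" if k: "K \<le> k" and E: "finite E" for k E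
    proof -
      let ?d = "\<lambda>l. \<Sum>i\<in>E. \<bar>coord (X l) i - x i\<bar>"
      have "?d \<longlonglongrightarrow> (\<Sum>i\<in>E. \<bar>x i - x i\<bar>)"
        by (intro tendsto_sum tendsto_rabs tendsto_diff lim tendsto_const)
      then have "(\<lambda>l. e + ?d l) \<longlonglongrightarrow> e + 0"
        by (intro tendsto_add tendsto_const) simp
      moreover have "tsnorm (restr E (\<lambda>i. coord (X k) i - x i)) \<le> e + ?d l" if l: "K \<le> l" for l
      proof -
        have eq: "restr E (\<lambda>i. coord (X k) i - x i) =
            (\<lambda>i. restr E (coord (X k - X l)) i + restr E (\<lambda>i. coord (X l) i - x i) i)"
          by (auto simp: restr_def)
        have "tsnorm (restr E (\<lambda>i. coord (X k) i - x i)) \<le>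
            tsnorm (restr E (coord (X k - X l))) + tsnorm (restr E (\<lambda>i. coord (X l) i - x i))"
          unfolding eq using E x0 by (intro tsnorm_triangle c00_restr_finite) auto
        also have "\<dots> \<le> e + ?d l"
        proof (rule add_mono)
          show "tsnorm (restr E (coord (X k - X l))) \<le> e"
            using tsnorm_restr_le_norm[OF E, of "X k - X l"] K k l by force
          have "tsnorm (restr E (\<lambda>i. coord (X l) i - x i)) \<le>
              (\<Sum>i\<in>E. \<bar>restr E (\<lambda>i. coord (X l) i - x i) i\<bar>)"
          proof (rule tsnorm_le_l1)
            show "restr E (\<lambda>i. coord (X l) i - x i) \<in> c00"
              using E x0 by (intro c00_restr_finite) auto
          qed (use E in \<open>auto simp: restr_def\<close>)
          then show "tsnorm (restr E (\<lambda>i. coord (X l) i - x i)) \<le> ?d l"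
            by (simp add: restr_def)
        qed
        finally show ?thesis .
      qed
      ultimately show ?thesis by (intro LIMSEQ_le_const[of _ e]) auto
    qed
    then show ?thesis by blast
  qed
  have "ts_cauchy x"
    unfolding ts_cauchy_def
  proof (intro allI impI)
    fix e :: real assume "0 < e"
    then have e: "0 < e/4" by simp
    obtain k where k: "\<And>E. finite E \<Longrightarrow> tsnorm (restr E (\<lambda>i. coord (X k) i - x i)) \<le> e/4"
      using close[OF e] by blast
    obtain M where M: "\<forall>m\<ge>M. \<forall>n\<ge>M.
        tsnorm (\<lambda>i. restr {..m} (coord (X k)) i - restr {..n} (coord (X k)) i) < e/4"
      using ts_cauchy_coord[of "X k"] e unfolding ts_cauchy_def by blast
    have "tsnorm (\<lambda>i. restr {..m} x i - restr {..n} x i) < e" if "M \<le> m" "M \<le> n" for m n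
    proof -
      let ?a = "\<lambda>i. restr {..m} (coord (X k)) i - restr {..n} (coord (X k)) i"
      let ?u = "\<lambda>n. restr {..n} (\<lambda>i. coord (X k) i - x i)"
      have u: "?u p \<in> c00" for p using x0 by (intro c00_restr_finite) auto
      have a: "?a \<in> c00" by (intro c00_diff c00_restr_coord) auto
      have "(\<lambda>i. restr {..m} x i - restr {..n} x i) = (\<lambda>i. ?a i + (?u n i - ?u m i))"
        by (auto simp: restr_def)
      then have "tsnorm (\<lambda>i. restr {..m} x i - restr {..n} x i) \<le>
          tsnorm ?a + tsnorm (\<lambda>i. ?u n i - ?u m i)"
        by (simp only: tsnorm_triangle[OF a c00_diff[OF u u]])
      moreover have "tsnorm (\<lambda>i. ?u n i - ?u m i) \<le> tsnorm (?u n) + tsnorm (?u m)"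
        by (rule tsnorm_diff_triangle[OF u u])
      moreover have "tsnorm ?a < e/4" using M that by blast
      moreover have "tsnorm (?u n) \<le> e/4" "tsnorm (?u m) \<le> e/4" by (rule k, simp)+
      ultimately show ?thesis using e by linarith
    qed
    then show "\<exists>M. \<forall>m\<ge>M. \<forall>n\<ge>M. tsnorm (\<lambda>i. restr {..m} x i - restr {..n} x i) < e" by blast
  qed
  then have coord_x: "coord (Abs_tsirelson x) = x" using x0 by (simp add: coord_Abs)
  have "X \<longlonglongrightarrow> Abs_tsirelson x"
  proof (rule LIMSEQ_I)
    fix e :: real assume "0 < e"
    then have "0 < e/2" by simp
    then obtain K where
      K: "\<forall>k\<ge>K. \<forall>E. finite E \<longrightarrow> tsnorm (restr E (\<lambda>i. coord (X k) i - x i)) \<le> e/2"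
      using close by blast
    have "norm (X k - Abs_tsirelson x) \<le> e/2" if "K \<le> k" for k
      by (rule norm_le_tsirelson) (use K that in \<open>simp add: coord_x\<close>)
    then show "\<exists>K. \<forall>k\<ge>K. norm (X k - Abs_tsirelson x) < e"
      using \<open>0 < e\<close> by (intro exI[of _ K]) (force intro: le_less_trans)
  qed
  then show "convergent X" by (rule convergentI)
qed

definition unit_vec :: "nat \<Rightarrow> tsirelson" where
  "unit_vec i = Abs_tsirelson (\<lambda>k. if k = i \<and> 1 \<le> i then 1 else 0)"

lemma norm_of_c00: assumes "x \<in> c00" shows "norm (Abs_tsirelson x) = tsnorm x"
proof -
  have c: "coord (Abs_tsirelson x) = x"
    using assms ts_cauchy_c00 by (intro coord_Abs) (auto simp: c00_def)
  obtain M where M: "\<And>i. x i \<noteq> 0 \<Longrightarrow> i \<le> M"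
    using assms by (auto simp: c00_def finite_nat_set_iff_bounded_le)
  have "restr {..n} x = x" if "M \<le> n" for n
    using M that by (force simp: restr_def)
  then have "(\<lambda>n. tsnorm (restr {..n} x)) \<longlonglongrightarrow> tsnorm x"
    by (intro tendsto_eventually) (auto simp: eventually_sequentially intro!: exI[of _ M])
  then show ?thesis using norm_LIMSEQ[of "Abs_tsirelson x"] c LIMSEQ_unique by metis
qed

lemma coord_unit_vec: "1 \<le> i \<Longrightarrow> coord (unit_vec i) = (\<lambda>k. if k = i then 1 else 0)"
  unfolding unit_vec_def by (subst coord_Abs) (auto intro!: ts_cauchy_c00 simp: c00_def)

lemma closure_span_unit_vec: "closure (span (unit_vec ` {1..})) = UNIV"
proof -
  have "x \<in> closure (span (unit_vec ` {1..}))" for x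
    unfolding closure_approachable
  proof (intro allI impI)
    fix e :: real assume "0 < e"
    then have "0 < e/2" by simp
    then obtain M where M: "\<forall>m\<ge>M. \<forall>n\<ge>M.
        tsnorm (\<lambda>i. restr {..m} (coord x) i - restr {..n} (coord x) i) < e/2"
      using ts_cauchy_coord[of x] unfolding ts_cauchy_def by blast
    define y where "y = (\<Sum>i\<in>{1..M}. coord x i *\<^sub>R unit_vec i)"
    have "coord (\<Sum>i\<in>{1..m}. coord x i *\<^sub>R unit_vec i) = restr {..m} (coord x)" for m
    proof (induction m)
      case 0
      then show ?case by (auto simp: restr_def)
    next
      case (Suc m)
      moreover have "coord (unit_vec (Suc m)) = (\<lambda>k. if k = Suc m then 1 else 0)"
        by (rule coord_unit_vec) simp
      ultimately show ?case by (auto simp: restr_def fun_eq_iff le_Suc_eq)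
    qed
    then have y: "coord y = restr {..M} (coord x)" by (simp add: y_def)
    have "norm (y - x) \<le> e/2"
    proof (rule norm_le_tsirelson)
      fix n
      show "tsnorm (restr {..n} (coord (y - x))) \<le> e/2"
      proof (cases "M \<le> n")
        case True
        have "restr {..n} (coord (y - x)) =
            (\<lambda>i. restr {..M} (coord x) i - restr {..n} (coord x) i)"
          using True by (auto simp: y restr_def)
        then show ?thesis using M True by (simp add: less_imp_le)
      next
        case False
        then have "restr {..n} (coord (y - x)) = (\<lambda>i. 0)" by (auto simp: y restr_def)
        then show ?thesis using \<open>0 < e\<close> by (simp add: tsnorm_zero)
      qed
    qed
    moreover have "y \<in> span (unit_vec ` {1..})"
      unfolding y_def by (intro span_sum span_scale span_base) auto
    ultimately show "\<exists>y\<in>span (unit_vec ` {1..}). dist y x < e"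
      using \<open>0 < e\<close> by (auto simp: dist_norm intro!: bexI[of _ y])
  qed
  then show ?thesis by blast
qed


section \<open>The norms given by admissible trees\<close>

text \<open>Levels are not stored: the root of a tree has level \<open>0\<close> and the successors of a node of
  level \<open>m\<close> have level \<open>m + 1\<close>. A set may be its own unique successor (a \<open>1\<close>-admissible partition
  with one member), so the same set can occur on consecutive levels;
  without this, no tree of positive depth would contain \<open>1\<close> and the functionals below would not
  be norms. A node is terminal if its
  list of successors is empty.\<close>

datatype set_tree = Node (tree_root: "nat set") (successors: "set_tree list")

fun admissible_tree :: "set_tree \<Rightarrow> bool" where
  "admissible_tree (Node E ts) \<longleftrightarrow> finite E \<and> 0 \<notin> E \<and>
     (ts \<noteq> [] \<longrightarrow> admissible 1 (map tree_root ts) \<and> \<Union>(set (map tree_root ts)) = E) \<and>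
     (\<forall>t\<in>set ts. admissible_tree t)"

text \<open>\<open>terminals m t\<close> lists the terminal sets of \<open>t\<close> with their levels, the root having level \<open>m\<close>.\<close>

fun terminals :: "nat \<Rightarrow> set_tree \<Rightarrow> (nat \<times> nat set) list" where
  "terminals m (Node E ts) =
     (if ts = [] then [(m, E)] else concat (map (\<lambda>t. terminals (Suc m) t) ts))"

definition tree_norm :: "nat \<Rightarrow> nat \<Rightarrow> tsirelson \<Rightarrow> real" where
  "tree_norm j n x =
     (SUP t\<in>{t. admissible_tree t \<and> (\<forall>(m, E)\<in>set (terminals 0 t). \<exists>k. m = j + n * k)}.
        \<Sum>(m, E)\<leftarrow>terminals 0 t. (1/2) ^ m * supn (restr E (coord x)))"


text \<open>The supremum defining \<^term>\<open>tree_norm\<close> is over a nonempty set, bounded by the norm.\<close>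

lemma terminals_sum_le:
  "admissible_tree t \<Longrightarrow>
     (\<Sum>(m, E)\<leftarrow>terminals l t. (1/2) ^ m * supn (restr E (coord x)))
       \<le> (1/2) ^ l * tsnorm (restr (tree_root t) (coord x))"
proof (induction t arbitrary: l)
  case (Node E ts)
  let ?g = "\<lambda>(m, E). (1/2) ^ m * supn (restr E (coord x))"
  have E: "restr E (coord x) \<in> c00" using Node.prems by (simp add: c00_restr_coord)
  show ?case
  proof (cases "ts = []")
    case True
    have "supn (restr E (coord x)) \<le> tsnorm (restr E (coord x))"
      by (rule supn_le) (rule tsnorm_ge_coord[OF E])
    then show ?thesis using True by simp
  next
    case False
    then have adm: "admissible 1 (map tree_root ts)" and un: "\<Union>(set (map tree_root ts)) = E"
      using Node.prems by auto
    have "(\<Sum>p\<leftarrow>concat (map (terminals (Suc l)) ts). ?g p) =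
        (\<Sum>t\<leftarrow>ts. \<Sum>p\<leftarrow>terminals (Suc l) t. ?g p)" for ts
      by (induction ts) auto
    then have "(\<Sum>p\<leftarrow>terminals l (Node E ts). ?g p) =
        (\<Sum>t\<leftarrow>ts. \<Sum>p\<leftarrow>terminals (Suc l) t. ?g p)"
      using False by simp
    also have "\<dots> \<le> (\<Sum>t\<leftarrow>ts. (1/2) ^ Suc l * tsnorm (restr (tree_root t) (coord x)))"
    proof (rule sum_list_mono)
      fix t assume t: "t \<in> set ts"
      then have "admissible_tree t" using Node.prems by simp
      from Node.IH[OF t this, of "Suc l"]
      show "(\<Sum>p\<leftarrow>terminals (Suc l) t. ?g p) \<le> (1/2) ^ Suc l * tsnorm (restr (tree_root t) (coord x))" .
    qed
    also have "\<dots> = (1/2) ^ l *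
        (1/2 * (\<Sum>t\<leftarrow>ts. tsnorm (restr (tree_root t) (restr E (coord x)))))"
    proof -
      have "restr (tree_root t) (restr E (coord x)) = restr (tree_root t) (coord x)" if "t \<in> set ts" for t
        using un that by (auto simp: restr_def fun_eq_iff)
      then have "(\<Sum>t\<leftarrow>ts. tsnorm (restr (tree_root t) (restr E (coord x)))) =
          (\<Sum>t\<leftarrow>ts. tsnorm (restr (tree_root t) (coord x)))"
        by (metis (no_types, lifting) map_cong)
      then show ?thesis
        by (simp only: sum_list_const_mult power_Suc mult.assoc mult.left_commute)
    qed
    also have "\<dots> \<le> (1/2) ^ l * tsnorm (restr E (coord x))"
      using tsnorm_admissible[OF E adm] by (intro mult_left_mono) (auto simp: comp_def)
    finally show ?thesis by simp
  qed
qed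

lemma bdd_tree_norm:
  "(\<Sum>(m, E)\<leftarrow>terminals 0 t. (1/2) ^ m * supn (restr E (coord x))) \<le> norm x"
  if "admissible_tree t"
proof -
  have "finite (tree_root t)" using that by (cases t) auto
  then show ?thesis
    using terminals_sum_le[OF that, where l = 0 and x = x] tsnorm_restr_le_norm[of "tree_root t" x] by simp
qed

lemma tree_norm_nonempty:
  "{t. admissible_tree t \<and> (\<forall>(m, E)\<in>set (terminals 0 t). \<exists>k. m = j + n * k)} \<noteq> {}"
proof -
  have "{1} \<in> schreier 1"
    by (auto intro!: exI[of _ "[{1}]"] simp: set_le_def)
  then have adm: "admissible 1 [{1}]" by (simp add: admissible_def)
  have "\<exists>t. admissible_tree t \<and> tree_root t = {1} \<and> terminals m t = [(m + j, {1})]" for m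
  proof (induction j arbitrary: m)
    case 0
    show ?case by (rule exI[of _ "Node {1} []"]) simp
  next
    case (Suc j)
    obtain t where "admissible_tree t" "tree_root t = {1}" "terminals (Suc m) t = [(Suc m + j, {1})]"
      using Suc[of "Suc m"] by blast
    then show ?case using adm by (intro exI[of _ "Node {1} [t]"]) simp
  qed
  from this[of 0] obtain t where t: "admissible_tree t" "terminals 0 t = [(j, {1})]"
    by auto
  have k: "\<exists>k. j = j + n * k" by (rule exI[of _ 0]) simp
  then have "\<forall>(m, E)\<in>set (terminals 0 t). \<exists>k. m = j + n * k"
    unfolding t(2) using k by simp
  with t(1) show ?thesis by blast
qed


section \<open>Block subspaces and stability\<close>

definition block_basis :: "(nat \<Rightarrow> tsirelson) \<Rightarrow> (nat \<Rightarrow> tsirelson) \<Rightarrow> bool" where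
  "block_basis b y \<longleftrightarrow> (\<exists>(F :: nat \<Rightarrow> nat set) a.
     (\<forall>i. finite (F i) \<and> F i \<noteq> {} \<and> set_less (F i) (F (Suc i)) \<and>
          y i = (\<Sum>k\<in>F i. a k *\<^sub>R b k) \<and> y i \<noteq> 0))"

definition closed_span :: "(nat \<Rightarrow> tsirelson) \<Rightarrow> tsirelson set" where
  "closed_span y = closure (span (range y))"

text \<open>The unit vector basis is \<open>e\<^sub>1, e\<^sub>2, \<dots>\<close>; block bases are indexed from \<open>0\<close>.\<close>

definition unit_basis :: "nat \<Rightarrow> tsirelson" where
  "unit_basis i = unit_vec (Suc i)"

definition block_subspace :: "tsirelson set \<Rightarrow> bool" where
  "block_subspace Y \<longleftrightarrow> (\<exists>y. block_basis unit_basis y \<and> Y = closed_span y)"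

definition block_subspace_of :: "tsirelson set \<Rightarrow> tsirelson set \<Rightarrow> bool" where
  "block_subspace_of Z Y \<longleftrightarrow> (\<exists>y z. block_basis unit_basis y \<and> Y = closed_span y \<and>
     block_basis y z \<and> Z = closed_span z)"

definition unit_sphere :: "tsirelson set \<Rightarrow> tsirelson set" where
  "unit_sphere Z = {z \<in> Z. norm z = 1}"

definition stabilizing_constant :: "real \<Rightarrow> bool" where
  "stabilizing_constant K \<longleftrightarrow> 1 < K \<and>
     (\<forall>Y n. block_subspace Y \<longrightarrow> 1 \<le> n \<longrightarrow>
        (\<exists>Z d. block_subspace_of Z Y \<and> 0 < d \<and>
           (\<forall>j<n. \<forall>z\<in>unit_sphere Z. d \<le> tree_norm j n z \<and> tree_norm j n z \<le> K * d)))"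

definition n_stable :: "real \<Rightarrow> nat \<Rightarrow> real \<Rightarrow> tsirelson set \<Rightarrow> bool" where
  "n_stable K n d Z \<longleftrightarrow>
     d = (INF j\<in>{..<n}. INF z\<in>unit_sphere Z. tree_norm j n z) \<and>
     d \<le> (SUP j\<in>{..<n}. SUP z\<in>unit_sphere Z. tree_norm j n z) \<and>
     (SUP j\<in>{..<n}. SUP z\<in>unit_sphere Z. tree_norm j n z) \<le> K * d"

end

theory Submission
  imports Defs
begin

text \<open>A norming functional of \<open>x\<close> is a sum over the terminal sets of a tree. Sorting these by their
  level modulo \<open>n\<close> gives \<open>norm x \<le> (\<Sum>j<n. tree_norm j n x)\<close>. Conversely
  \<open>(\<Sum>j<n. tree_norm j n x) \<le> 8 * norm x\<close> if \<open>x\<close> vanishes on the first \<open>n + 1\<close> positions: the weights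
  at a point in trees of different residue classes are distinct powers of \<open>1/2\<close>, so up to a factor
  \<open>2\<close> each point may be kept in one of the \<open>n\<close> trees only. The trees, now disjoint but interlaced, are
  then rearranged into trees of intervals, as in the proof that the modified Tsirelson norm is
  equivalent to the Tsirelson norm; it costs one more level. On a subspace on which the values \<open>tree_norm j n\<close>
  of unit vectors lie between \<open>d\<close> and \<open>K * d\<close> both estimates together force \<open>d\<close> to be of order \<open>1/n\<close>.\<close>

section \<open>Admissible families of order one\<close>

text \<open>The minima of disjoint nonempty sets are distinct, and a member of S_1 is covered by
  sets of at most one element, each bounded below by the number of these sets. So that number bounds
  the length of the family and lies below every minimum. Conversely the singletons of the minima
  form such a cover.\<close>

lemma admissible_1_iff:
  "admissible 1 Es \<longleftrightarrow>
     (\<forall>E\<in>set Es. finite E \<and> E \<noteq> {} \<and> length Es \<le> Min E) \<and> sorted_wrt set_less Es"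
proof
  assume adm: "admissible 1 Es"
  then have fin: "\<And>E. E \<in> set Es \<Longrightarrow> finite E \<and> E \<noteq> {}" and sorted: "sorted_wrt set_less Es"
    and S: "Min ` set Es \<in> schreier 1"
    by (auto simp: admissible_def)
  obtain Fs where Fs: "Min ` set Es = \<Union>(set Fs)"
    "\<And>F. F \<in> set Fs \<Longrightarrow> set_le {length Fs} F \<and> F \<in> schreier 0"
    using S by auto
  have card1: "card F \<le> 1" if "F \<in> set Fs" for F
    using Fs(2)[OF that] by auto
  have "inj_on Min (set Es)"
    using admissible_disjoint(2)[OF adm] fin Min_in unfolding inj_on_def by (metis disjoint_iff)
  then have "length Es = card (\<Union>(set Fs))"
    using admissible_disjoint(1)[OF adm] by (metis Fs(1) card_image distinct_card)
  also have "\<dots> \<le> (\<Sum>F\<in>set Fs. card F)"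
    by (rule card_Union_le_sum_card)
  also have "\<dots> \<le> (\<Sum>F\<in>set Fs. 1)"
    by (rule sum_mono) (rule card1)
  also have "\<dots> \<le> length Fs"
    by (simp add: card_length)
  finally have len: "length Es \<le> length Fs" .
  have "length Es \<le> Min E" if "E \<in> set Es" for E
  proof -
    have "Min E \<in> \<Union>(set Fs)"
      using that unfolding Fs(1)[symmetric] by (rule imageI)
    then obtain F where F: "F \<in> set Fs" "Min E \<in> F"
      by (elim UnionE)
    then have "F = {Min E}"
      using Fs(2)[OF F(1)] by auto
    then show ?thesis
      using Fs(2)[OF F(1)] len by (simp add: set_le_def)
  qed
  then show "(\<forall>E\<in>set Es. finite E \<and> E \<noteq> {} \<and> length Es \<le> Min E) \<and> sorted_wrt set_less Es"
    using fin sorted by blast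
next
  assume *: "(\<forall>E\<in>set Es. finite E \<and> E \<noteq> {} \<and> length Es \<le> Min E) \<and> sorted_wrt set_less Es"
  have "set_less {Min E} {Min F}" if "E \<in> set Es" "F \<in> set Es" "set_less E F" for E F
  proof -
    have "finite E" "E \<noteq> {}" "F \<noteq> {}"
      using * that by blast+
    then have "Min E \<le> Max E" by simp
    then show ?thesis
      using that(3) \<open>E \<noteq> {}\<close> \<open>F \<noteq> {}\<close> by (simp add: set_less_def)
  qed
  then have sorted: "sorted_wrt set_less (map (\<lambda>E. {Min E}) Es)"
    using * by (simp add: sorted_wrt_map) (auto elim: sorted_wrt_mono_rel[rotated])
  have ne: "1 \<le> Min E" if "E \<in> set Es" for E
  proof -
    have "1 \<le> length Es" using that by (cases Es) auto
    then show ?thesis using * that le_trans by blast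
  qed
  have "\<forall>F\<in>set (map (\<lambda>E. {Min E}) Es). set_le {length (map (\<lambda>E. {Min E}) Es)} F \<and> F \<in> schreier 0"
    using * ne by (auto simp: set_le_def simp del: Min.bounded_iff)
  moreover have "Min ` set Es = \<Union>(set (map (\<lambda>E. {Min E}) Es))"
    by auto
  ultimately have "Min ` set Es \<in> schreier (Suc 0)"
    using sorted unfolding schreier.simps(2) by blast
  then show "admissible 1 Es"
    using * by (simp add: admissible_def)
qed

lemma set_less_iff:
  assumes "finite E" "finite F"
  shows "set_less E F \<longleftrightarrow> (\<forall>i\<in>E. \<forall>j\<in>F. i < j)"
  using assms by (cases "E = {} \<or> F = {}") (auto simp: set_less_def)

section \<open>Packing points into vacant slots\<close>

text \<open>Positions in a tree of slots: a node of level \<open>s\<close> whose minimum is \<open>p\<close> has room for \<open>p\<close>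
  successors. When the point \<open>p\<close> is to become a leaf of level \<open>l\<close>, it takes a vacant slot of level
  \<open>s \<le> l\<close> and leaves \<open>p - 1\<close> vacant slots on each of the levels \<open>s + 1, \<dots>, l\<close>. The vacant slots
  are counted by \<open>c\<close>; their order is ignored.\<close>

definition refine :: "(nat \<Rightarrow> nat) \<Rightarrow> nat \<Rightarrow> nat \<Rightarrow> nat \<Rightarrow> nat \<Rightarrow> nat" where
  "refine c p s l = (\<lambda>t. if t = s then c s - 1 else if s < t \<and> t \<le> l then c t + (p - 1) else c t)"

fun packable :: "(nat \<Rightarrow> nat) \<Rightarrow> (nat \<times> nat) list \<Rightarrow> bool" where
  "packable c [] \<longleftrightarrow> True"
| "packable c ((p, l) # xs) \<longleftrightarrow> (\<exists>s\<le>l. 0 < c s \<and> packable (refine c p s l) xs)"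

lemma packable_mono: "packable c xs \<Longrightarrow> (\<And>t. c t \<le> d t) \<Longrightarrow> packable d xs"
proof (induction c xs arbitrary: d rule: packable.induct)
  case (2 c p l xs)
  then obtain s where s: "s \<le> l" "0 < c s" "packable (refine c p s l) xs"
    by auto
  have "refine c p s l t \<le> refine d p s l t" for t
    using "2.prems"(2) by (auto simp: refine_def intro: diff_le_mono)
  then have "packable (refine d p s l) xs"
    using "2.IH" s by blast
  moreover have "0 < d s"
    using s(2) "2.prems"(2)[of s] by simp
  ultimately show ?case
    using s(1) by auto
qed simp

lemma refine_add_left: "0 < c s \<Longrightarrow> (\<lambda>t. refine c p s l t + d t) = refine (\<lambda>t. c t + d t) p s l"
  by (auto simp: refine_def)

lemma packable_append: "packable c xs \<Longrightarrow> packable d ys \<Longrightarrow> packable (\<lambda>t. c t + d t) (xs @ ys)"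
proof (induction c xs rule: packable.induct)
  case (1 c)
  then show ?case by (auto elim: packable_mono)
next
  case (2 c p l xs)
  then obtain s where s: "s \<le> l" "0 < c s" "packable (refine c p s l) xs"
    by auto
  have "packable (refine (\<lambda>t. c t + d t) p s l) (xs @ ys)"
    using "2.IH"[OF s(3) "2.prems"(2)] s by (simp add: refine_add_left)
  then show ?case
    using s by auto
qed

text \<open>Every point keeps using slots of its own packing, so the steps of the two packings can
  be interleaved. This is where ignoring the order of slots pays: interlaced trees become one
  increasing list of points.\<close>

lemma packable_merge:
  assumes "packable c xs" "packable d ys"
    and "sorted_wrt (<) (map fst xs)" "sorted_wrt (<) (map fst ys)"
    and "fst ` set xs \<inter> fst ` set ys = {}"
  shows "\<exists>zs. sorted_wrt (<) (map fst zs) \<and> set zs = set xs \<union> set ys \<and> packable (\<lambda>t. c t + d t) zs"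
  using assms
proof (induction "length xs + length ys" arbitrary: c d xs ys)
  case 0
  then show ?case by (intro exI[of _ "[]"]) auto
next
  case (Suc k)
  \<comment> \<open>The case that the smallest point heads \<open>xs\<close>; the other case follows
    by exchanging the two lists.\<close>
  have left: "\<exists>zs. sorted_wrt (<) (map fst zs) \<and> set zs = set xs \<union> set ys \<and>
      packable (\<lambda>t. c t + d t) zs"
    if H: "xs = (p, l) # xs'" "\<And>z. z \<in> set ys \<Longrightarrow> p < fst z"
      "packable c xs" "packable d ys" "sorted_wrt (<) (map fst xs)" "sorted_wrt (<) (map fst ys)"
      "fst ` set xs \<inter> fst ` set ys = {}" "Suc k = length xs + length ys"
    for xs ys c d p l xs'
  proof -
    obtain s where s: "s \<le> l" "0 < c s" "packable (refine c p s l) xs'"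
      using H(1,3) by auto
    obtain zs where zs: "sorted_wrt (<) (map fst zs)" "set zs = set xs' \<union> set ys"
      "packable (\<lambda>t. refine c p s l t + d t) zs"
      using Suc.hyps(1)[of xs' ys "refine c p s l" d] s(3) H by auto
    have "packable (\<lambda>t. c t + d t) ((p, l) # zs)"
      using s zs(3) by (auto simp: refine_add_left)
    moreover have "sorted_wrt (<) (map fst ((p, l) # zs))"
      using zs(1,2) H(1,2,5) by auto
    ultimately show ?thesis
      using zs(2) H(1) by (intro exI[of _ "(p, l) # zs"]) auto
  qed
  have comm: "(\<lambda>t. d t + c t) = (\<lambda>t. c t + d t)"
    by (simp add: add.commute)
  show ?case
  proof (cases xs)
    case Nil
    then show ?thesis using Suc.prems by (intro exI[of _ ys]) (auto elim: packable_mono)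
  next
    case xs: (Cons a xs')
    obtain p l where a: "a = (p, l)" by fastforce
    show ?thesis
    proof (cases ys)
      case Nil
      then show ?thesis using Suc.prems by (intro exI[of _ xs]) (auto elim: packable_mono)
    next
      case ys: (Cons b ys')
      obtain q m where b: "b = (q, m)" by fastforce
      have "p \<noteq> q" using Suc.prems(5) by (simp add: xs ys a b)
      then consider "p < q" | "q < p" by linarith
      then show ?thesis
      proof cases
        case 1
        have "p < fst z" if "z \<in> set ys" for z
          using Suc.prems(4) 1 that by (auto simp: ys b)
        then show ?thesis
          using left[of xs p l xs' ys c d] Suc.prems Suc.hyps(2) xs a by simp
      next
        case 2
        have "q < fst z" if "z \<in> set xs" for z
          using Suc.prems(3) 2 that by (auto simp: xs a)
        then have "\<exists>zs. sorted_wrt (<) (map fst zs) \<and> set zs = set ys \<union> set xs \<and>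
            packable (\<lambda>t. d t + c t) zs"
          using left[of ys q m ys' xs d c] Suc.prems Suc.hyps(2) ys b by (simp add: Int_commute add.commute)
        then show ?thesis by (simp add: comm Un_commute)
      qed
    qed
  qed
qed

section \<open>Greedy packing\<close>

text \<open>The greedy strategy: every point takes the deepest vacant slot of level at most
  \<open>l\<close>. The levels from \<open>s + 1\<close> to \<open>l\<close> are empty before and
  hold exactly \<open>p - 1\<close> slots afterwards, so counts that lie below all later points
  continue to do so.\<close>

fun tight :: "(nat \<Rightarrow> nat) \<Rightarrow> (nat \<times> nat) list \<Rightarrow> bool" where
  "tight c [] \<longleftrightarrow> True"
| "tight c ((p, l) # xs) \<longleftrightarrow>
     (\<exists>s\<le>l. 0 < c s \<and> (\<forall>t. s < t \<and> t \<le> l \<longrightarrow> c t = 0) \<and> tight (refine c p s l) xs)"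

text \<open>The number of slots of level \<open>T\<close> available if every node has \<open>q\<close> successors.\<close>

primrec capacity :: "nat \<Rightarrow> (nat \<Rightarrow> nat) \<Rightarrow> nat \<Rightarrow> nat" where
  "capacity q c 0 = c 0"
| "capacity q c (Suc T) = q * capacity q c T + c (Suc T)"

text \<open>With branching number \<open>p\<close> a slot is worth \<open>p\<close> slots of the
  next level, and opening it for the point \<open>p\<close> leaves \<open>p - 1\<close> of them: one
  unit is lost on each level from \<open>s\<close> to \<open>l\<close>. On deeper levels the loss
  consists of the descendants that the leaf would have had.\<close>

lemma capacity_refine:
  assumes "0 < c s" "s \<le> l" "0 < p"
  shows "capacity p (refine c p s l) T + (if T < s then 0 else if T \<le> l then 1 else p ^ (T - l)) =
    capacity p c T"
proof (induction T)
  case 0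
  then show ?case using assms by (auto simp: refine_def)
next
  case (Suc T)
  consider "Suc T < s" | "Suc T = s" | "s \<le> T" "T < l" | "l \<le> T" using assms by linarith
  then show ?case
  proof cases
    case 3
    then have "capacity p c T = capacity p (refine c p s l) T + 1" using Suc by simp
    then show ?thesis using 3 assms by (simp add: refine_def algebra_simps)
  next
    case 4
    then have "capacity p c T = capacity p (refine c p s l) T + p ^ (T - l)"
      using Suc assms by (cases "T = l") auto
    then show ?thesis using 4 assms by (simp add: refine_def algebra_simps Suc_diff_le)
  qed (use Suc assms in \<open>auto simp: refine_def\<close>)
qed

text \<open>A larger branching number magnifies a nonnegative surplus. Each point is measured with
  itself as branching number, and the points increase.\<close>

lemma capacity_mono_base:
  assumes "q \<le> p" and dom: "\<And>T. capacity q c T \<le> capacity q d T"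
  shows "capacity p c T \<le> capacity p d T"
proof -
  \<comment> \<open>Signed differences, since on a single level \<open>d\<close> may have fewer
    slots than \<open>c\<close>.\<close>
  have "int (capacity q d T) - int (capacity q c T) \<le> int (capacity p d T) - int (capacity p c T)"
  proof (induction T)
    case (Suc T)
    have "int q * (int (capacity q d T) - int (capacity q c T)) \<le>
        int p * (int (capacity p d T) - int (capacity p c T))"
      using Suc assms(1) dom[of T] by (intro mult_mono) auto
    then show ?case by (simp add: algebra_simps)
  qed simp
  then show ?thesis using dom[of T] by linarith
qed

lemma capacity_ge: "T \<le> U \<Longrightarrow> q ^ (U - T) * capacity q c T \<le> capacity q c U"
proof (induction U)
  case (Suc U)
  show ?case
  proof (cases "T = Suc U")
    case False
    then have "q * (q ^ (U - T) * capacity q c T) \<le> q * capacity q c U"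
      using Suc by (intro mult_left_mono) auto
    moreover have "q ^ (Suc U - T) * capacity q c T = q * (q ^ (U - T) * capacity q c T)"
      using False Suc.prems by (simp add: Suc_diff_le)
    ultimately show ?thesis unfolding capacity.simps by linarith
  qed simp
qed simp

lemma capacity_eq:
  "T \<le> U \<Longrightarrow> (\<And>t. T < t \<Longrightarrow> t \<le> U \<Longrightarrow> c t = 0) \<Longrightarrow> capacity q c U = q ^ (U - T) * capacity q c T"
proof (induction U)
  case (Suc U)
  then show ?case by (cases "T = Suc U") (auto simp: Suc_diff_le)
qed simp

lemma capacity_pos_iff: "0 < q \<Longrightarrow> 0 < capacity q c T \<longleftrightarrow> (\<exists>t\<le>T. 0 < c t)"
  by (induction T) (auto simp: le_Suc_eq)

text \<open>Using the deepest vacant slot that is not too deep is optimal.\<close>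

lemma capacity_refine_le:
  assumes p: "0 < p" and dom: "\<And>T. capacity p c T \<le> capacity p d T"
    and a: "a \<le> l" "0 < c a"
    and s: "s \<le> l" "0 < d s" "\<And>t. s < t \<Longrightarrow> t \<le> l \<Longrightarrow> d t = 0"
  shows "capacity p (refine c p a l) T \<le> capacity p (refine d p s l) T"
proof (cases "s \<le> T \<and> T < l \<and> T < a")
  \<comment> \<open>Only on these levels has the greedy choice lost a unit and the other choice not.
    Between \<open>T\<close> and \<open>l\<close> the counts \<open>d\<close> vanish while
    \<open>c\<close> has a slot at \<open>a\<close>; as \<open>d\<close> still dominates at level
    \<open>l\<close>, it dominates strictly at level \<open>T\<close>.\<close>
  case True
  have "p ^ (l - T) * capacity p c T < capacity p c l"
  proof -
    have "p ^ (l - T) * capacity p c T < p ^ (l - a) * (p ^ (a - T) * capacity p c T + 1)"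
      using True a p by (simp add: distrib_left flip: mult.assoc power_add)
    also have "p ^ (a - T) * capacity p c T + 1 \<le> capacity p c a"
    proof -
      obtain b where b: "a = Suc b" using True by (cases a) auto
      have "p * (p ^ (b - T) * capacity p c T) \<le> p * capacity p c b"
        using capacity_ge[of T b p c] True b by (intro mult_left_mono) auto
      moreover have "p ^ (a - T) * capacity p c T = p * (p ^ (b - T) * capacity p c T)"
        using True b by (simp add: Suc_diff_le)
      moreover have "1 \<le> c (Suc b)" using a b by simp
      ultimately show ?thesis unfolding b capacity.simps by linarith
    qed
    then have "p ^ (l - a) * (p ^ (a - T) * capacity p c T + 1) \<le> p ^ (l - a) * capacity p c a"
      by (rule mult_left_mono) simp
    also have "\<dots> \<le> capacity p c l"
      by (rule capacity_ge[OF a(1)])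
    finally show ?thesis .
  qed
  also have "\<dots> \<le> capacity p d l" by (rule dom)
  also have "\<dots> = p ^ (l - T) * capacity p d T"
    using True s(3) by (intro capacity_eq) auto
  finally have "capacity p c T < capacity p d T" by simp
  then show ?thesis
    using capacity_refine[of c a l p T] capacity_refine[of d s l p T] a(1,2) s(1,2) p True by simp
next
  case False
  then show ?thesis
    using capacity_refine[of c a l p T] capacity_refine[of d s l p T] a(1,2) s(1,2) p dom[of T]
    by (auto split: if_splits)
qed

text \<open>The greedy counts dominate those of the given packing in capacity on every level, and
  the capacity at level \<open>l\<close> is positive exactly if some slot of level at most
  \<open>l\<close> is vacant. Hence the greedy packing never gets stuck. The branching number
  \<open>q\<close> is raised to the current point at each step.\<close>

lemma packable_imp_tight:
  assumes "packable c xs" "sorted_wrt (<) (map fst xs)" "\<And>p. p \<in> fst ` set xs \<Longrightarrow> q \<le> p \<and> 0 < p"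
    and "\<And>T. capacity q c T \<le> capacity q d T"
  shows "tight d xs"
  using assms
proof (induction c xs arbitrary: d q rule: packable.induct)
  case (2 c p l xs)
  have p: "q \<le> p" "0 < p" using "2.prems"(3) by auto
  have dom: "capacity p c T \<le> capacity p d T" for T
    by (rule capacity_mono_base[OF p(1) "2.prems"(4)])
  obtain a where a: "a \<le> l" "0 < c a" "packable (refine c p a l) xs"
    using "2.prems"(1) by auto
  have "0 < capacity p d l"
    using capacity_pos_iff[OF p(2), of c l] a dom[of l] by auto
  then have "\<exists>s. s \<le> l \<and> 0 < d s" using capacity_pos_iff[OF p(2)] by blast
  then have "\<exists>s. (s \<le> l \<and> 0 < d s) \<and> (\<forall>t. t \<le> l \<and> 0 < d t \<longrightarrow> t \<le> s)"
    using Nat.ex_has_greatest_nat[of "\<lambda>s. s \<le> l \<and> 0 < d s" _ l] by blast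
  then obtain s where s: "s \<le> l" "0 < d s" "\<And>t. t \<le> l \<Longrightarrow> 0 < d t \<Longrightarrow> t \<le> s" by blast
  then have s0: "\<And>t. s < t \<Longrightarrow> t \<le> l \<Longrightarrow> d t = 0" by (metis gr0I leD)
  have "tight (refine d p s l) xs"
  proof (rule "2.IH"[OF a(3)])
    show "\<And>p'. p' \<in> fst ` set xs \<Longrightarrow> p \<le> p' \<and> 0 < p'"
      using "2.prems"(2) p by auto
    show "sorted_wrt (<) (map fst xs)" using "2.prems"(2) by simp
  qed (rule capacity_refine_le[OF p(2) dom a(1,2) s(1,2) s0])
  then show ?case using s s0 by auto
qed simp

section \<open>Trees of intervals\<close>

text \<open>If the tree is to consist of intervals, the vacant slots form a stack, here with the first
  slot at the head, and taking a slot discards those before it.\<close>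

fun opened :: "nat \<Rightarrow> nat \<Rightarrow> nat \<Rightarrow> nat list" where
  "opened p s 0 = []"
| "opened p s (Suc k) = opened p (Suc s) k @ replicate (p - 1) (Suc s)"

fun stackable :: "nat list \<Rightarrow> (nat \<times> nat) list \<Rightarrow> bool" where
  "stackable st [] \<longleftrightarrow> True"
| "stackable st ((p, l) # xs) \<longleftrightarrow>
     (\<exists>pre s st'. st = pre @ s # st' \<and> s \<le> l \<and> stackable (opened p s (l - s) @ st') xs)"

text \<open>In a tree of intervals the vacant slots next to the last leaf are the deepest, whence
  the decreasing levels.\<close>

primrec stack :: "(nat \<Rightarrow> nat) \<Rightarrow> nat \<Rightarrow> nat list" where
  "stack c 0 = replicate (c 0) 0"
| "stack c (Suc T) = replicate (c (Suc T)) (Suc T) @ stack c T"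

lemma stack_cong: "(\<And>t. t \<le> T \<Longrightarrow> c t = d t) \<Longrightarrow> stack c T = stack d T"
  by (induction T) auto

lemma stack_opened:
  "(\<And>t. s < t \<Longrightarrow> t \<le> s + k \<Longrightarrow> c t = p - 1) \<Longrightarrow> stack c (s + k) = opened p s k @ stack c s"
proof (induction k arbitrary: s)
  case (Suc k)
  have "stack c (Suc s + k) = opened p (Suc s) k @ stack c (Suc s)"
    by (rule Suc.IH) (use Suc.prems in auto)
  then show ?case using Suc.prems by simp
qed simp

lemma stack_split:
  assumes "u \<le> T" "c u = Suc (d u)" "\<And>t. t < u \<Longrightarrow> d t = c t"
  shows "\<exists>pre. stack c T = pre @ u # stack d u"
  using assms(1)
proof (induction T)
  case 0
  then show ?case using assms(2) by (intro exI[of _ "[]"]) simp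
next
  case (Suc T)
  show ?case
  proof (cases "u = Suc T")
    case True
    have "stack c T = stack d T"
      by (rule stack_cong) (simp add: True assms(3))
    then show ?thesis using assms(2) by (intro exI[of _ "[]"]) (simp add: True)
  next
    case False
    then obtain pre where "stack c T = pre @ u # stack d u" using Suc by auto
    then show ?thesis by (intro exI[of _ "replicate (c (Suc T)) (Suc T) @ pre"]) simp
  qed
qed

text \<open>Discarding is made good by placing every point one level deeper: at level \<open>l + 1\<close> the last
  point leaves more slots than \<open>c\<close> has on any deeper level, and opening one of
  these replaces all discarded slots. Here \<open>L\<close> is the new level of the last point and \<open>o'\<close> counts
  the slots on the stack.\<close>

lemma tight_imp_stackable:
  assumes "tight c xs" "sorted_wrt (<) (map fst xs)"
    and "\<And>p t. p \<in> fst ` set xs \<Longrightarrow> Suc (c t) < p"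
    and "\<And>t. t < L \<Longrightarrow> c t \<le> o' t" "c L < o' L"
  shows "stackable (stack o' L) (map (\<lambda>(p, l). (p, Suc l)) xs)"
  using assms
proof (induction c xs arbitrary: o' L rule: tight.induct)
  case (2 c p l xs)
  then obtain s where s: "s \<le> l" "0 < c s" "\<And>t. s < t \<Longrightarrow> t \<le> l \<Longrightarrow> c t = 0"
    "tight (refine c p s l) xs"
    by auto
  have c: "Suc (c t) < p" for t using "2.prems"(3) by simp
  \<comment> \<open>Below level \<open>L\<close> the stack has the slot used by the greedy packing.
    Otherwise the surplus slot of level \<open>L\<close> is opened down to level
    \<open>Suc l\<close>.\<close>
  define u where "u = min s L"
  define o2 where "o2 = (\<lambda>t. if t = u then o' u - 1 else if u < t then p - 1 else o' t)"
  have u: "u \<le> s" "u \<le> L" "u < L \<Longrightarrow> u = s" by (auto simp: u_def)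
  have ou: "0 < o' u"
    using "2.prems"(4)[of s] "2.prems"(5) s(2) by (cases "s < L") (auto simp: u_def)
  obtain pre where pre: "stack o' L = pre @ u # stack o2 u"
    using stack_split[OF u(2), of o' o2] ou by (auto simp: o2_def)
  have "stack o2 (Suc l) = opened p u (Suc l - u) @ stack o2 u"
    using stack_opened[of u "Suc l - u" o2 p] u s(1) by (simp add: o2_def)
  moreover have "stackable (stack o2 (Suc l)) (map (\<lambda>(p, l). (p, Suc l)) xs)"
  proof (rule "2.IH"[OF s(4)])
    show "sorted_wrt (<) (map fst xs)" using "2.prems"(2) by simp
    show "Suc (refine c p s l t) < q" if "q \<in> fst ` set xs" for q t
    proof -
      have "p < q" using "2.prems"(2) that by auto
      then show ?thesis using c[of t] s(3)[of t] c[of s] by (auto simp: refine_def)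
    qed
    \<comment> \<open>Beyond \<open>u\<close> the \<open>p - 1\<close> opened slots suffice because
      \<open>Suc (c t) < p\<close>; at \<open>u = L\<close> the slot spent is the surplus
      one.\<close>
    show "refine c p s l t \<le> o2 t" if "t < Suc l" for t
    proof -
      consider "t < u" | "t = u" | "u < t" by linarith
      then show ?thesis
      proof cases
        case 1
        then show ?thesis using "2.prems"(4)[of t] u by (auto simp: o2_def refine_def)
      next
        case t: 2
        show ?thesis
        proof (cases "u = L")
          case True
          then show ?thesis
            using t u "2.prems"(5) by (auto simp: o2_def refine_def)
        next
          case False
          then have "u = s" "c u \<le> o' u" using u "2.prems"(4)[of u] by auto
          then show ?thesis using t by (simp add: o2_def refine_def diff_le_mono)
        qed
      next
        case 3
        then show ?thesis
          using c[of t] c[of s] s(3)[of t] that by (auto simp: o2_def refine_def)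
      qed
    qed
    show "refine c p s l (Suc l) < o2 (Suc l)"
      using c[of "Suc l"] s(1) u by (auto simp: o2_def refine_def)
  qed
  ultimately have "stackable (opened p u (Suc l - u) @ stack o2 u)
      (map (\<lambda>(p, l). (p, Suc l)) xs)"
    by simp
  moreover have "u \<le> Suc l" using u s(1) by linarith
  ultimately have "\<exists>pre s st'. stack o' L = pre @ s # st' \<and> s \<le> Suc l \<and>
      stackable (opened p s (Suc l - s) @ st') (map (\<lambda>(p, l). (p, Suc l)) xs)"
    using pre by blast
  then show ?case by simp
qed simp

section \<open>From stacks to the Tsirelson norm\<close>

text \<open>The estimate that a node of level \<open>s\<close> with the points of \<open>xs\<close>
  as leaves would yield. It is carried along instead of the tree itself.\<close>

definition level_bounded :: "(nat \<Rightarrow> real) \<Rightarrow> nat \<Rightarrow> (nat \<times> nat) list \<Rightarrow> bool" where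
  "level_bounded x s xs \<longleftrightarrow>
     (\<Sum>(p, l)\<leftarrow>xs. (1/2) ^ l * \<bar>x p\<bar>) \<le> (1/2) ^ s * tsnorm (restr (fst ` set xs) x)"

lemma level_bounded_Nil: "level_bounded x s []"
proof -
  have "restr {} x = (\<lambda>i. 0)" by (simp add: restr_def)
  then show ?thesis by (simp add: level_bounded_def tsnorm_zero)
qed

lemma sum_list_concat_map:
  "(\<Sum>a\<leftarrow>concat xss. f a) = (\<Sum>xs\<leftarrow>xss. \<Sum>a\<leftarrow>xs. f a :: real)"
  by (induction xss) auto

lemma restr_restr: "E \<subseteq> U \<Longrightarrow> restr E (restr U x) = restr E x"
  by (auto simp: restr_def fun_eq_iff)

text \<open>The supports are successive and start no earlier than their number; once empty ones, of
  norm zero, are dropped, they form a 1-admissible family. The 2 undoes the 1/2 in the norm.\<close>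

lemma sum_tsnorm_segments_le:
  assumes x0: "x 0 = 0" and sorted: "sorted_wrt (<) (map fst (concat Ds))"
    and len: "\<And>p. p \<in> fst ` set (concat Ds) \<Longrightarrow> length Ds \<le> p"
  shows "(\<Sum>D\<leftarrow>Ds. tsnorm (restr (fst ` set D) x)) \<le> 2 * tsnorm (restr (fst ` set (concat Ds)) x)"
proof -
  define Es where "Es = map (\<lambda>D. fst ` set D) (filter (\<lambda>D. D \<noteq> []) Ds)"
  let ?U = "fst ` set (concat Ds)"
  have "sorted_wrt set_less (map (\<lambda>D. fst ` set D) (filter (\<lambda>D. D \<noteq> []) Ds))" using sorted
  proof (induction Ds)
    case (Cons D Ds)
    have "set_less (fst ` set D) (fst ` set D')" if "D' \<in> set Ds" for D'
      using Cons.prems that by (auto simp: set_less_iff sorted_wrt_append)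
    then show ?case using Cons by (auto simp: sorted_wrt_append)
  qed simp
  then have sorted_Es: "sorted_wrt set_less Es" by (simp add: Es_def)
  have "length Es \<le> Min E" if "E \<in> set Es" for E
  proof -
    have "finite E" "E \<noteq> {}" "E \<subseteq> ?U" using that by (auto simp: Es_def)
    then have "length Ds \<le> Min E" using len Min_in by blast
    moreover have "length Es \<le> length Ds" by (simp add: Es_def)
    ultimately show ?thesis by linarith
  qed
  then have adm: "admissible 1 Es"
    unfolding admissible_1_iff using sorted_Es by (auto simp: Es_def simp del: Min.bounded_iff)
  have "(\<Sum>D\<leftarrow>Ds. tsnorm (restr (fst ` set D) x)) = (\<Sum>E\<leftarrow>Es. tsnorm (restr E x))"
  proof -
    have "restr {} x = (\<lambda>i. 0)" by (simp add: restr_def)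
    then show ?thesis unfolding Es_def by (induction Ds) (auto simp: tsnorm_zero)
  qed
  also have "\<dots> = (\<Sum>E\<leftarrow>Es. tsnorm (restr E (restr ?U x)))"
  proof -
    have "restr E x = restr E (restr ?U x)" if "E \<in> set Es" for E
    proof -
      have "E \<subseteq> ?U" using that by (auto simp: Es_def)
      then show ?thesis by (simp only: restr_restr)
    qed
    then show ?thesis by (metis (no_types, lifting) map_cong)
  qed
  also have "\<dots> \<le> 2 * tsnorm (restr ?U x)"
    using tsnorm_admissible[OF _ adm, of "restr ?U x"] x0 by (simp add: c00_restr_finite)
  finally show ?thesis .
qed

text \<open>Joining the segments as successors of one node gains a factor 2, that is, one
  level.\<close>

lemma level_bounded_concat:
  assumes x0: "x 0 = 0" and norm: "\<And>D. D \<in> set Ds \<Longrightarrow> level_bounded x (Suc s) D"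
    and sorted: "sorted_wrt (<) (map fst (concat Ds))"
    and len: "\<And>p. p \<in> fst ` set (concat Ds) \<Longrightarrow> length Ds \<le> p"
  shows "level_bounded x s (concat Ds)"
proof -
  have "(\<Sum>(p, l)\<leftarrow>concat Ds. (1/2) ^ l * \<bar>x p\<bar>) \<le>
      (\<Sum>D\<leftarrow>Ds. (1/2) ^ Suc s * tsnorm (restr (fst ` set D) x))"
    unfolding sum_list_concat_map using norm by (intro sum_list_mono) (simp add: level_bounded_def)
  also have "\<dots> = (1/2) ^ Suc s * (\<Sum>D\<leftarrow>Ds. tsnorm (restr (fst ` set D) x))"
    by (rule sum_list_const_mult)
  also have "\<dots> \<le> (1/2) ^ Suc s * (2 * tsnorm (restr (fst ` set (concat Ds)) x))"
    by (intro mult_left_mono sum_tsnorm_segments_le x0 sorted len) auto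
  finally show ?thesis by (simp add: level_bounded_def)
qed

text \<open>The nodes opened for a point \<open>p\<close> are closed from the deepest upwards: on
  each level the segment collected so far and those of the \<open>p - 1\<close> other slots are
  \<open>p\<close> successive sets with all points at least \<open>p\<close>.\<close>

lemma level_bounded_opened:
  assumes x0: "x 0 = 0" and C: "level_bounded x (s + k) C"
    and Ds: "list_all2 (level_bounded x) (opened p s k) Ds"
    and sorted: "sorted_wrt (<) (map fst (C @ concat Ds))"
    and p: "\<And>q. q \<in> fst ` set (C @ concat Ds) \<Longrightarrow> p \<le> q" "0 < p"
  shows "level_bounded x s (C @ concat Ds)"
  using C Ds sorted p(1)
proof (induction k arbitrary: s Ds)
  case (Suc k)
  obtain Ds1 Ds2 where D: "Ds = Ds1 @ Ds2" "list_all2 (level_bounded x) (opened p (Suc s) k) Ds1"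
    "list_all2 (level_bounded x) (replicate (p - 1) (Suc s)) Ds2"
    using Suc.prems(2) by (auto simp: list_all2_append1)
  have len: "length Ds2 = p - 1" using D(3) by (auto dest: list_all2_lengthD)
  have "level_bounded x (Suc s) D'" if "D' \<in> set Ds2" for D'
    using D(3) that by (auto simp: list_all2_conv_all_nth in_set_conv_nth)
  moreover have "level_bounded x (Suc s) (C @ concat Ds1)"
  proof (rule Suc.IH[OF _ D(2)])
    show "sorted_wrt (<) (map fst (C @ concat Ds1))"
      using Suc.prems(3) unfolding D(1) concat_append append_assoc[symmetric] map_append[of _ "_ @ _"]
      by (simp only: sorted_wrt_append)
  qed (use Suc.prems D(1) in auto)
  ultimately have "level_bounded x s (concat ((C @ concat Ds1) # Ds2))"
    using Suc.prems(3,4) D(1) len p(2) by (intro level_bounded_concat x0) auto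
  then show ?case using D(1) by simp
qed simp

text \<open>Each slot receives the points placed below it: discarded slots the empty segment, the
  slot taken its point together with the segments of the slots it opened.\<close>

lemma stackable_imp_level_bounded:
  assumes x0: "x 0 = 0" and "stackable st xs" "sorted_wrt (<) (map fst xs)"
    and "\<And>p. p \<in> fst ` set xs \<Longrightarrow> 0 < p"
  shows "\<exists>Ds. list_all2 (level_bounded x) st Ds \<and> concat Ds = xs"
  using assms(2-)
proof (induction st xs rule: stackable.induct)
  case (1 st)
  have "list_all2 (level_bounded x) st (replicate (length st) [])"
    by (simp add: list_all2_conv_all_nth level_bounded_Nil)
  then show ?case by (intro exI[of _ "replicate (length st) []"]) simp
next
  case (2 st p l xs)
  obtain pre s st' where st: "st = pre @ s # st'" "s \<le> l" "stackable (opened p s (l - s) @ st') xs"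
    using "2.prems"(1) by auto
  obtain Ds where Ds: "list_all2 (level_bounded x) (opened p s (l - s) @ st') Ds" "concat Ds = xs"
    using "2.IH"[OF st(3)] "2.prems" by auto
  obtain Ds1 Ds2 where D: "Ds = Ds1 @ Ds2" "list_all2 (level_bounded x) (opened p s (l - s)) Ds1"
    "list_all2 (level_bounded x) st' Ds2"
    using Ds(1) by (auto simp: list_all2_append1)
  have "\<bar>restr {p} x p\<bar> \<le> tsnorm (restr {p} x)"
    using x0 by (intro tsnorm_ge_coord c00_restr_finite) auto
  then have "level_bounded x l [(p, l)]"
    by (simp add: level_bounded_def restr_def)
  then have "level_bounded x s ([(p, l)] @ concat Ds1)"
  proof (intro level_bounded_opened[where k = "l - s", OF x0 _ D(2)])
    show "sorted_wrt (<) (map fst ([(p, l)] @ concat Ds1))"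
      using "2.prems"(2) Ds(2) D(1) by (auto simp: sorted_wrt_append)
    show "p \<le> q" if "q \<in> fst ` set ([(p, l)] @ concat Ds1)" for q
      using that "2.prems"(2) Ds(2) D(1) by (auto intro: less_imp_le)
  qed (use st "2.prems" in auto)
  moreover have "list_all2 (level_bounded x) pre (replicate (length pre) [])"
    by (simp add: list_all2_conv_all_nth level_bounded_Nil)
  ultimately have "list_all2 (level_bounded x) st
      (replicate (length pre) [] @ (((p, l) # concat Ds1) # Ds2))"
    using D(3) st(1) by (auto intro: list_all2_appendI)
  moreover have "concat (replicate (length pre) [] @ (((p, l) # concat Ds1) # Ds2)) = (p, l) # xs"
    using Ds(2) D(1) by simp
  ultimately show ?case by blast
qed

text \<open>One factor 2 pays for placing all points one level deeper, the other for the
  1-admissible family of the \<open>n + 1\<close> final segments.\<close>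

lemma packable_norm_bound:
  assumes "packable (\<lambda>t. if t = 0 then n else 0) xs" "sorted_wrt (<) (map fst xs)"
    and far: "\<And>p. p \<in> fst ` set xs \<Longrightarrow> n + 2 \<le> p"
  shows "(\<Sum>(p, l)\<leftarrow>xs. (1/2) ^ l * \<bar>coord z p\<bar>) \<le> 4 * norm z"
proof -
  let ?c = "\<lambda>t :: nat. if t = 0 then n else 0"
  let ?x = "coord z" and ?xs = "map (\<lambda>(p, l). (p, Suc l)) xs"
  have "tight ?c xs"
    by (rule packable_imp_tight[OF assms(1,2), of 1]) (use far in force)+
  \<comment> \<open>There are \<open>n + 1\<close> slots because the stack must strictly exceed
    \<open>?c 0 = n\<close> at its last level; \<open>Suc (?c t) < p\<close> is the reason for
    \<open>n + 2 \<le> p\<close>.\<close>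
  then have "stackable (stack (\<lambda>_. n + 1) 0) ?xs"
    by (rule tight_imp_stackable) (use assms(2) far in force)+
  moreover have fst: "map fst ?xs = map fst xs" by auto
  moreover have "fst ` set ?xs = fst ` set xs" by force
  moreover have "0 < p" if "p \<in> fst ` set xs" for p
    using far[OF that] by simp
  ultimately have "\<exists>Ds. list_all2 (level_bounded ?x) (stack (\<lambda>_. n + 1) 0) Ds \<and> concat Ds = ?xs"
    using assms(2) by (intro stackable_imp_level_bounded) (simp_all only: coord_0)
  then obtain Ds where Ds: "list_all2 (level_bounded ?x) (replicate (n + 1) 0) Ds" "concat Ds = ?xs"
    by auto
  have norm: "level_bounded ?x 0 D" if "D \<in> set Ds" for D
    using Ds(1) that by (auto simp: list_all2_conv_all_nth in_set_conv_nth simp del: replicate.simps)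
  have len: "length Ds = n + 1" using Ds(1) by (auto dest: list_all2_lengthD)
  have "(\<Sum>(p, l)\<leftarrow>xs. (1/2) ^ l * \<bar>?x p\<bar>) = 2 * (\<Sum>(p, l)\<leftarrow>?xs. (1/2) ^ l * \<bar>?x p\<bar>)"
    by (induction xs) auto
  also have "(\<Sum>(p, l)\<leftarrow>?xs. (1/2) ^ l * \<bar>?x p\<bar>) \<le> (\<Sum>D\<leftarrow>Ds. tsnorm (restr (fst ` set D) ?x))"
    unfolding Ds(2)[symmetric] sum_list_concat_map
    using norm by (intro sum_list_mono) (simp add: level_bounded_def)
  also have "\<dots> \<le> 2 * tsnorm (restr (fst ` set (concat Ds)) ?x)"
  proof (rule sum_tsnorm_segments_le)
    show "sorted_wrt (<) (map fst (concat Ds))" using assms(2) by (simp only: Ds(2) fst)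
    show "length Ds \<le> p" if "p \<in> fst ` set (concat Ds)" for p
    proof -
      have "n + 2 \<le> p"
        using far that \<open>fst ` set ?xs = fst ` set xs\<close> by (simp only: Ds(2))
      then show ?thesis by (simp add: len)
    qed
  qed simp
  also have "tsnorm (restr (fst ` set (concat Ds)) ?x) \<le> norm z"
    by (rule tsnorm_restr_le_norm) simp
  finally show ?thesis by simp
qed

section \<open>The upper bound for sums of tree norms\<close>

text \<open>If the first point takes the single slot of level \<open>l\<close> instead of one of
  level \<open>Suc l\<close>, it leaves \<open>p - 1 \<ge> k - 1\<close> slots on level
  \<open>Suc l\<close> and the same slots on deeper levels.\<close>

lemma packable_open:
  assumes "packable (\<lambda>s. if s = Suc l then k else 0) xs" "\<And>p. p \<in> fst ` set xs \<Longrightarrow> k \<le> p"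
  shows "packable (\<lambda>s. if s = l then 1 else 0) xs"
proof (cases xs)
  case (Cons a xs')
  obtain p m where a: "a = (p, m)" by fastforce
  let ?c = "\<lambda>s. if s = Suc l then k else 0" and ?d = "\<lambda>s. if s = l then 1 else 0 :: nat"
  have m: "Suc l \<le> m" and pack: "packable (refine ?c p (Suc l) m) xs'"
    using assms(1) by (auto simp: Cons a split: if_splits)
  have "k \<le> p" using assms(2) by (auto simp: Cons a)
  then have "packable (refine ?d p l m) xs'"
    using m by (intro packable_mono[OF pack]) (auto simp: refine_def)
  then show ?thesis using m by (auto simp: Cons a)
qed simp

text \<open>Every terminal set is represented by one of its points, later one at which its supremum
  norm is attained; \<open>Q\<close> selects the points to be kept.\<close>

definition tree_points :: "(nat set \<Rightarrow> nat) \<Rightarrow> (nat \<times> nat \<Rightarrow> bool) \<Rightarrow> nat \<Rightarrow> set_tree \<Rightarrow> (nat \<times> nat) list"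
  where "tree_points pt Q l t = filter Q (map (\<lambda>(m, E). (pt E, m)) (terminals l t))"

lemma tree_points_Node:
  "ts \<noteq> [] \<Longrightarrow> tree_points pt Q l (Node E ts) = concat (map (tree_points pt Q (Suc l)) ts)"
  unfolding tree_points_def by (simp add: map_concat filter_concat comp_def)

text \<open>The packings of the successors are concatenated, one slot of level \<open>Suc l\<close>
  for each. By admissibility no point is smaller than the number of successors, so one slot of level
  \<open>l\<close> can be opened for all of them.\<close>

lemma tree_points_packable:
  assumes pt: "\<And>E. finite E \<Longrightarrow> E \<noteq> {} \<Longrightarrow> pt E \<in> E"
    and "admissible_tree t" "tree_root t \<noteq> {}"
  shows "sorted_wrt (<) (map fst (tree_points pt Q l t)) \<and>
    fst ` set (tree_points pt Q l t) \<subseteq> tree_root t \<and>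
    packable (\<lambda>s. if s = l then 1 else 0) (tree_points pt Q l t)"
  using assms(2,3)
proof (induction t arbitrary: l)
  case (Node E ts)
  show ?case
  proof (cases "ts = []")
    case True
    then show ?thesis using Node.prems pt[of E] by (simp add: tree_points_def)
  next
    case False
    then have adm: "admissible 1 (map tree_root ts)" and un: "\<Union>(set (map tree_root ts)) = E"
      using Node.prems by auto
    then have roots: "\<forall>t\<in>set ts. finite (tree_root t) \<and> tree_root t \<noteq> {} \<and> length ts \<le> Min (tree_root t)"
      and sorted: "sorted_wrt set_less (map tree_root ts)"
      unfolding admissible_1_iff by (auto simp del: Min.bounded_iff)
    have IH: "\<forall>t\<in>set ts. sorted_wrt (<) (map fst (tree_points pt Q (Suc l) t)) \<and>
        fst ` set (tree_points pt Q (Suc l) t) \<subseteq> tree_root t \<and>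
        packable (\<lambda>s. if s = Suc l then 1 else 0) (tree_points pt Q (Suc l) t)"
      using Node roots by simp
    let ?P = "\<lambda>ts. concat (map (tree_points pt Q (Suc l)) ts)"
    have fin: "\<forall>t\<in>set ts. finite (tree_root t)" using roots by blast
    have "sorted_wrt (<) (map fst (?P ts)) \<and> fst ` set (?P ts) \<subseteq> \<Union>(set (map tree_root ts)) \<and>
        packable (\<lambda>s. if s = Suc l then length ts else 0) (?P ts)"
      using IH sorted fin
    proof (induction ts)
      case (Cons t ts)
      then have *: "sorted_wrt (<) (map fst (?P ts))" "fst ` set (?P ts) \<subseteq> \<Union>(set (map tree_root ts))"
        "packable (\<lambda>s. if s = Suc l then length ts else 0) (?P ts)"
        and t: "sorted_wrt (<) (map fst (tree_points pt Q (Suc l) t))"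
        "fst ` set (tree_points pt Q (Suc l) t) \<subseteq> tree_root t"
        "packable (\<lambda>s. if s = Suc l then 1 else 0) (tree_points pt Q (Suc l) t)"
        by auto
      have less: "i < j" if "i \<in> tree_root t" "j \<in> \<Union>(set (map tree_root ts))" for i j
        using Cons.prems(2,3) that by (auto simp: set_less_iff)
      have "packable (\<lambda>s. (if s = Suc l then 1 else 0) + (if s = Suc l then length ts else 0))
          (?P (t # ts))"
        using packable_append[OF t(3) *(3)] by simp
      then have "packable (\<lambda>s. if s = Suc l then length (t # ts) else 0) (?P (t # ts))"
        by (rule packable_mono) simp
      moreover have "sorted_wrt (<) (map fst (?P (t # ts)))"
        unfolding list.map concat.simps map_append sorted_wrt_append
        using t(1,2) *(1,2) less by (metis list.set_map subsetD)
      moreover have "fst ` set (?P (t # ts)) \<subseteq> \<Union>(set (map tree_root (t # ts)))"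
        unfolding list.map concat.simps set_append image_Un list.set Union_insert
        using t(2) *(2) by (rule Un_mono)
      ultimately show ?case by blast
    qed simp
    then have P: "sorted_wrt (<) (map fst (?P ts))" "fst ` set (?P ts) \<subseteq> E"
      "packable (\<lambda>s. if s = Suc l then length ts else 0) (?P ts)"
      unfolding un by blast+
    have "length ts \<le> p" if p: "p \<in> E" for p
    proof -
      obtain t where "t \<in> set ts" "p \<in> tree_root t" using p un by auto
      then show ?thesis using roots Min_le le_trans by blast
    qed
    then have "packable (\<lambda>s. if s = l then 1 else 0) (?P ts)"
      using P(2) by (intro packable_open[OF P(3)]) blast
    then show ?thesis
      unfolding tree_points_Node[OF False] set_tree.sel using P(1,2) by blast
  qed
qed

lemma terminals_finite:
  "admissible_tree t \<Longrightarrow> tree_root t \<noteq> {} \<Longrightarrow> (m, E) \<in> set (terminals l t) \<Longrightarrow> finite E \<and> E \<noteq> {}"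
proof (induction t arbitrary: l)
  case (Node F ts)
  show ?case
  proof (cases "ts = []")
    case False
    then obtain t where t: "t \<in> set ts" "(m, E) \<in> set (terminals (Suc l) t)"
      using Node.prems(3) by auto
    have "admissible 1 (map tree_root ts)" using False Node.prems(1) by simp
    then have "tree_root t \<noteq> {}" using t(1) by (auto simp: admissible_def)
    then show ?thesis using Node.IH[OF t(1) _ _ t(2)] Node.prems(1) t(1) by simp
  qed (use Node.prems in auto)
qed

lemma ex_supn_restr_le:
  assumes "finite E" "E \<noteq> {}"
  shows "\<exists>p\<in>E. supn (restr E x) \<le> \<bar>x p\<bar>"
proof -
  have "Max ((\<lambda>i. \<bar>x i\<bar>) ` E) \<in> (\<lambda>i. \<bar>x i\<bar>) ` E" using assms by (intro Max_in) auto
  then obtain p where p: "p \<in> E" "Max ((\<lambda>i. \<bar>x i\<bar>) ` E) = \<bar>x p\<bar>" by auto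
  have "\<bar>restr E x i\<bar> \<le> \<bar>x p\<bar>" for i
  proof (cases "i \<in> E")
    case True
    then have "\<bar>x i\<bar> \<le> Max ((\<lambda>i. \<bar>x i\<bar>) ` E)" using assms(1) by (intro Max_ge) auto
    then show ?thesis using True p(2) by (simp add: restr_def)
  qed (simp add: restr_def)
  then show ?thesis using p(1) supn_le by blast
qed

lemma sum_half_powers_le:
  assumes "finite M" "\<And>m. m \<in> M \<Longrightarrow> a \<le> m"
  shows "(\<Sum>m\<in>M. (1/2) ^ m) \<le> (2 :: real) * (1/2) ^ a"
proof -
  obtain b where b: "\<And>m. m \<in> M \<Longrightarrow> m < b"
    using assms(1) unfolding finite_nat_set_iff_bounded by blast
  have "(\<Sum>m\<in>M. (1/2) ^ m) \<le> (\<Sum>m\<in>{a..<max a b}. (1/2 :: real) ^ m)"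
    by (rule sum_mono2) (use assms(2) b in \<open>auto simp: less_max_iff_disj\<close>)
  also have "\<dots> \<le> 2 * (1/2) ^ a"
  proof -
    have "(\<Sum>m\<in>{a..<a + k}. (1/2 :: real) ^ m) = 2 * (1/2) ^ a - 2 * (1/2) ^ (a + k)" for k
      by (induction k) auto
    from this[of "max a b - a"] show ?thesis by simp
  qed
  finally show ?thesis .
qed

text \<open>At each point the trees put distinct weights \<open>(1/2) ^ m\<close>, of which only the largest matters;
  keeping only that one makes the supports of the trees disjoint.\<close>

lemma sum_trees_le:
  assumes t: "\<And>j. j < n \<Longrightarrow> admissible_tree (t j)"
    and levels: "\<And>j m E. j < n \<Longrightarrow> (m, E) \<in> set (terminals 0 (t j)) \<Longrightarrow> m mod n = j"
    and far: "\<And>i. i < n + 2 \<Longrightarrow> coord z i = 0"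
  shows "(\<Sum>j<n. \<Sum>(m, E)\<leftarrow>terminals 0 (t j). (1/2) ^ m * supn (restr E (coord z))) \<le> 8 * norm z"
proof -
  let ?x = "coord z"
  let ?g = "\<lambda>(p, m). (1/2) ^ m * \<bar>?x p\<bar>"
  obtain pt where pt: "\<And>E. finite E \<Longrightarrow> E \<noteq> {} \<Longrightarrow> pt E \<in> E \<and> supn (restr E ?x) \<le> \<bar>?x (pt E)\<bar>"
    using ex_supn_restr_le[of _ ?x] by metis
  \<comment> \<open>An admissible tree with empty root is a single terminal set, which has no point
    to choose.\<close>
  define us where "us Q j = (if tree_root (t j) = {} then [] else tree_points pt Q 0 (t j))" for Q j
  have us: "sorted_wrt (<) (map fst (us Q j))" "packable (\<lambda>s. if s = 0 then 1 else 0) (us Q j)"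
    if "j < n" for Q j
    using tree_points_packable[of pt "t j" Q 0] pt t[OF that] by (auto simp: us_def)
  have us_set: "set (us Q j) = {u \<in> set (us (\<lambda>_. True) j). Q u}" for Q j
    by (auto simp: us_def tree_points_def)
  let ?us = "us (\<lambda>_. True)"
  have us_mod: "m mod n = j" if "j < n" "(p, m) \<in> set (?us j)" for j p m
    using levels[OF that(1)] that(2) by (auto simp: us_def tree_points_def split: if_splits)
  have tree_le: "(\<Sum>(m, E)\<leftarrow>terminals 0 (t j). (1/2) ^ m * supn (restr E ?x)) \<le> (\<Sum>u\<in>set (?us j). ?g u)"
    if j: "j < n" for j
  proof (cases "tree_root (t j) = {}")
    case True
    obtain E ts where E: "t j = Node E ts" by (cases "t j")
    have "ts = []" using t[OF j] True E by (cases ts) (auto simp: admissible_def)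
    moreover have "supn (restr {} ?x) = 0" by (simp add: restr_def supn_def)
    ultimately show ?thesis using True E by (simp add: us_def)
  next
    case False
    have "(\<Sum>(m, E)\<leftarrow>terminals 0 (t j). (1/2) ^ m * supn (restr E ?x)) \<le>
        (\<Sum>(m, E)\<leftarrow>terminals 0 (t j). (1/2) ^ m * \<bar>?x (pt E)\<bar>)"
    proof (rule sum_list_mono, clarify)
      fix m E assume "(m, E) \<in> set (terminals 0 (t j))"
      then have "supn (restr E ?x) \<le> \<bar>?x (pt E)\<bar>"
        using terminals_finite[OF t[OF j] False] pt by blast
      then show "(1/2) ^ m * supn (restr E ?x) \<le> (1/2) ^ m * \<bar>?x (pt E)\<bar>"
        by (rule mult_left_mono) simp
    qed
    also have "\<dots> = (\<Sum>u\<leftarrow>?us j. ?g u)"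
      using False by (simp add: us_def tree_points_def comp_def case_prod_unfold)
    also have "\<dots> = (\<Sum>u\<in>set (?us j). ?g u)"
    proof (rule sum_list_distinct_conv_sum_set)
      have "distinct (map fst (?us j))" using us(1)[OF j] by (simp add: strict_sorted_iff)
      then show "distinct (?us j)" by (simp add: distinct_map)
    qed
    finally show ?thesis .
  qed
  define U where "U = (\<Union>j<n. set (?us j))"
  define lev where "lev p = (LEAST m. (p, m) \<in> U)" for p
  \<comment> \<open>Keep the largest weight at each point. The points below \<open>n + 2\<close>,
    where \<open>z\<close> vanishes, are dropped to make room for the packing.\<close>
  define Q where "Q = (\<lambda>(p, m). n + 2 \<le> p \<and> m = lev p)"
  have finU: "finite U" by (simp add: U_def)
  have lev: "(p, lev p) \<in> U" "\<And>m. (p, m) \<in> U \<Longrightarrow> lev p \<le> m" if "p \<in> fst ` U" for p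
    using that unfolding lev_def by (auto intro: LeastI Least_le)
  \<comment> \<open>The trees are merged one after another, each adding one slot of level 0.\<close>
  have "\<exists>zs. sorted_wrt (<) (map fst zs) \<and> set zs = (\<Union>j<k. set (us Q j)) \<and>
      packable (\<lambda>s. if s = 0 then k else 0) zs" if "k \<le> n" for k
    using that
  proof (induction k)
    case (Suc k)
    then obtain zs where zs: "sorted_wrt (<) (map fst zs)" "set zs = (\<Union>j<k. set (us Q j))"
      "packable (\<lambda>s. if s = 0 then k else 0) zs"
      by auto
    \<comment> \<open>A common point would carry the level \<open>lev p\<close> in both lists, and a
      level modulo \<open>n\<close> determines its tree.\<close>
    have "fst ` set zs \<inter> fst ` set (us Q k) = {}"
    proof (rule ccontr)
      assume "\<not> ?thesis"
      then obtain p m m' where "(p, m) \<in> set zs" "(p, m') \<in> set (us Q k)" by force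
      then obtain j where "j < k" "(p, m) \<in> set (us Q j)" "(p, m') \<in> set (us Q k)"
        using zs(2) by auto
      then show False
        using us_mod[of j p m] us_mod[of k p m'] Suc.prems unfolding us_set[of Q] by (auto simp: Q_def)
    qed
    then obtain zs' where zs': "sorted_wrt (<) (map fst zs')" "set zs' = set zs \<union> set (us Q k)"
      "packable (\<lambda>s. (if s = 0 then k else 0) + (if s = 0 then 1 else 0)) zs'"
      using packable_merge[OF zs(3) us(2) zs(1) us(1), of k Q] Suc.prems by auto
    have "packable (\<lambda>s. if s = 0 then Suc k else 0) zs'"
      by (rule packable_mono[OF zs'(3)]) simp
    then show ?case using zs'(1,2) zs(2) by (auto simp: lessThan_Suc)
  qed (auto intro!: exI[of _ "[]"])
  then obtain zs where zs: "sorted_wrt (<) (map fst zs)" "set zs = (\<Union>j<n. set (us Q j))"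
    "packable (\<lambda>s. if s = 0 then n else 0) zs"
    by blast
  have zs_set: "set zs = {u \<in> U. Q u}" unfolding zs(2) us_set[of Q] U_def by blast
  have "(\<Sum>j<n. \<Sum>(m, E)\<leftarrow>terminals 0 (t j). (1/2) ^ m * supn (restr E ?x)) \<le>
      (\<Sum>j<n. \<Sum>u\<in>set (?us j). ?g u)"
    using tree_le by (intro sum_mono) auto
  also have "\<dots> = (\<Sum>u\<in>U. ?g u)"
    unfolding U_def
  proof (rule sum.UNION_disjoint[symmetric])
    show "\<forall>i\<in>{..<n}. \<forall>j\<in>{..<n}. i \<noteq> j \<longrightarrow> set (?us i) \<inter> set (?us j) = {}"
      using us_mod by (metis disjoint_iff lessThan_iff prod.collapse)
  qed auto
  also have "U = Sigma (fst ` U) (\<lambda>p. {m. (p, m) \<in> U})" by force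
  also have "(\<Sum>u\<in>\<dots>. ?g u) = (\<Sum>p\<in>fst ` U. \<Sum>m\<in>{m. (p, m) \<in> U}. (1/2) ^ m * \<bar>?x p\<bar>)"
  proof (rule sum.Sigma[symmetric])
    have "{m. (p, m) \<in> U} \<subseteq> snd ` U" for p by force
    then show "\<forall>p\<in>fst ` U. finite {m. (p, m) \<in> U}" using finU finite_subset by blast
  qed (use finU in simp)
  \<comment> \<open>A geometric series over the distinct levels at \<open>p\<close> gives the 2; the
    4 from the packing makes it 8.\<close>
  also have "\<dots> \<le> (\<Sum>p\<in>fst ` U. 2 * (1/2) ^ lev p * \<bar>?x p\<bar>)"
  proof (rule sum_mono)
    fix p assume p: "p \<in> fst ` U"
    have "{m. (p, m) \<in> U} \<subseteq> snd ` U" by force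
    then have "finite {m. (p, m) \<in> U}" using finU finite_subset by blast
    then have "(\<Sum>m\<in>{m. (p, m) \<in> U}. (1/2) ^ m) \<le> (2 :: real) * (1/2) ^ lev p"
      using lev(2)[OF p] by (intro sum_half_powers_le) auto
    then show "(\<Sum>m\<in>{m. (p, m) \<in> U}. (1/2) ^ m * \<bar>?x p\<bar>) \<le> 2 * (1/2) ^ lev p * \<bar>?x p\<bar>"
      unfolding sum_distrib_right[symmetric] by (rule mult_right_mono) simp
  qed
  also have "\<dots> = (\<Sum>p\<in>{p \<in> fst ` U. n + 2 \<le> p}. 2 * (1/2) ^ lev p * \<bar>?x p\<bar>)"
    using finU far by (intro sum.mono_neutral_right) (auto simp: not_le)
  also have "\<dots> = 2 * (\<Sum>u\<in>(\<lambda>p. (p, lev p)) ` {p \<in> fst ` U. n + 2 \<le> p}. ?g u)"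
    by (subst sum.reindex) (auto simp: inj_on_def sum_distrib_left mult.assoc)
  also have "(\<lambda>p. (p, lev p)) ` {p \<in> fst ` U. n + 2 \<le> p} = set zs"
    unfolding zs_set Q_def using lev(1) by force
  also have "(\<Sum>u\<in>set zs. ?g u) = (\<Sum>u\<leftarrow>zs. ?g u)"
  proof (rule sum_list_distinct_conv_sum_set[symmetric])
    have "distinct (map fst zs)" using zs(1) by (simp add: strict_sorted_iff)
    then show "distinct zs" by (simp add: distinct_map)
  qed
  also have "\<dots> \<le> 4 * norm z"
    by (rule packable_norm_bound[OF zs(3,1)]) (use zs_set in \<open>auto simp: Q_def\<close>)
  finally show ?thesis by simp
qed

section \<open>Splitting the norm along residue classes of levels\<close>

definition tree_value :: "(nat \<Rightarrow> real) \<Rightarrow> nat \<Rightarrow> set_tree option \<Rightarrow> real" where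
  "tree_value x l to = (case to of None \<Rightarrow> 0
     | Some t \<Rightarrow> \<Sum>(m, E)\<leftarrow>terminals l t. (1/2) ^ m * supn (restr E x))"

text \<open>The tree of a norming functional splits into \<open>n\<close> trees, one for each residue class of levels;
  \<open>None\<close> stands for a class without terminal sets.\<close>

lemma norming_split:
  assumes "f \<in> norming" "1 \<le> n" "finite B" "0 \<notin> B"
  shows "\<exists>T. (\<forall>r<n. \<forall>t. T r = Some t \<longrightarrow> admissible_tree t \<and> tree_root t \<noteq> {} \<and> tree_root t \<subseteq> B \<and>
      (\<forall>(m, E)\<in>set (terminals l t). m mod n = r)) \<and>
    (1/2) ^ l * pair f (restr B (coord x)) \<le> (\<Sum>r<n. tree_value (coord x) l (T r))"
  using assms
proof (induction arbitrary: l B rule: norming.induct)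
  case (unit c i)
  let ?x = "coord x"
  show ?case
  proof (cases "i \<in> B")
    case False
    then have "pair (\<lambda>k. if k = i then c else 0) (restr B ?x) = 0"
      unfolding pair_def by (intro sum.neutral) (auto simp: restr_def)
    then show ?thesis by (intro exI[of _ "\<lambda>_. None"]) (simp add: tree_value_def)
  next
    case True
    \<comment> \<open>One terminal set of level \<open>l\<close>, in the class of \<open>l\<close>;
      the other classes are empty.\<close>
    let ?T = "\<lambda>r. if r = l mod n then Some (Node {i} []) else None"
    have "pair (\<lambda>k. if k = i then c else 0) (restr B ?x) =
        (\<Sum>k\<in>B. (if k = i then c else 0) * restr B ?x k)"
      by (rule pair_eq) (use unit(3) in \<open>auto simp: restr_def\<close>)
    also have "\<dots> = (\<Sum>k\<in>B. if k = i then c * ?x i else 0)"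
      by (rule sum.cong) (auto simp: restr_def)
    also have "\<dots> = c * ?x i" using unit(3) True by simp
    also have "\<dots> \<le> \<bar>c\<bar> * \<bar>?x i\<bar>" by (metis abs_ge_self abs_mult)
    also have "\<dots> \<le> 1 * \<bar>?x i\<bar>" using unit(1) by (rule mult_right_mono) simp
    also have "\<bar>?x i\<bar> \<le> supn (restr {i} ?x)"
      using supn_ge[OF c00_restr_coord, of "{i}" x i] by (simp add: restr_def)
    finally have "(1/2) ^ l * pair (\<lambda>k. if k = i then c else 0) (restr B ?x) \<le>
        (1/2) ^ l * supn (restr {i} ?x)"
      by (intro mult_left_mono) auto
    also have "\<dots> = tree_value ?x l (?T (l mod n))"
      by (simp add: tree_value_def)
    also have "\<dots> = (\<Sum>r<n. if r = l mod n then tree_value ?x l (?T (l mod n)) else 0)"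
      using unit(2) by simp
    also have "\<dots> = (\<Sum>r<n. tree_value ?x l (?T r))"
      by (rule sum.cong) (auto simp: tree_value_def)
    finally have "(1/2) ^ l * pair (\<lambda>k. if k = i then c else 0) (restr B ?x) \<le>
        (\<Sum>r<n. tree_value ?x l (?T r))" .
    moreover have "0 < i" using True unit(4) by (metis gr0I)
    ultimately show ?thesis
      using True by (intro exI[of _ ?T]) auto
  qed
next
  case (step Es f)
  let ?x = "coord x"
  have Es: "\<forall>E\<in>set Es. finite E \<and> E \<noteq> {} \<and> length Es \<le> Min E" "sorted_wrt set_less Es"
    using step.hyps(1) unfolding admissible_1_iff by blast+
  \<comment> \<open>Confinement to \<open>B \<inter> E\<close> makes the trees obtained from
    different \<open>E\<close> successive.\<close>
  let ?P = "\<lambda>E T. (\<forall>r<n. \<forall>t. T r = Some t \<longrightarrow> admissible_tree t \<and> tree_root t \<noteq> {} \<and>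
        tree_root t \<subseteq> B \<inter> E \<and> (\<forall>(m, E)\<in>set (terminals (Suc l) t). m mod n = r)) \<and>
      (1/2) ^ Suc l * pair (f E) (restr (B \<inter> E) ?x) \<le> (\<Sum>r<n. tree_value ?x (Suc l) (T r))"
  have "\<forall>E\<in>set Es. \<exists>T. ?P E T"
    using step.IH[of _ "B \<inter> _" "Suc l"] step.prems by simp
  then obtain T where P: "\<forall>E\<in>set Es. ?P E (T E)"
    by (rule bchoice[THEN exE])
  have T: "admissible_tree t \<and> tree_root t \<noteq> {} \<and> tree_root t \<subseteq> B \<inter> E \<and>
      (\<forall>(m, E)\<in>set (terminals (Suc l) t). m mod n = r)"
    if "E \<in> set Es" "r < n" "T E r = Some t" for E r t
    using bspec[OF P that(1)] that(2,3) by simp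
  have val: "(1/2) ^ Suc l * pair (f E) (restr (B \<inter> E) ?x) \<le> (\<Sum>r<n. tree_value ?x (Suc l) (T E r))"
    if "E \<in> set Es" for E
    using bspec[OF P that] by (rule conjunct2)
  define ts where "ts r = List.map_filter (\<lambda>E. T E r) Es" for r
  \<comment> \<open>The trees of class \<open>r\<close> become successors of a new root, which is
    their union since successors must partition it.\<close>
  define S where "S r = (if ts r = [] then None else Some (Node (\<Union>(set (map tree_root (ts r)))) (ts r)))" for r
  have set_ts: "\<exists>E\<in>set Es. T E r = Some t" if "t \<in> set (ts r)" for r t
    using that by (auto simp: ts_def map_filter_def)
  \<comment> \<open>Omitting members of a 1-admissible family and shrinking the others lowers its
    length and raises its minima.\<close>
  have adm: "admissible 1 (map tree_root (ts r))" if r: "r < n" for r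
    unfolding admissible_1_iff
  proof
    have "length (ts r) \<le> length Es" by (simp add: ts_def map_filter_def)
    moreover have "finite (tree_root t) \<and> tree_root t \<noteq> {} \<and> length Es \<le> Min (tree_root t)"
      if t: "t \<in> set (ts r)" for t
    proof -
      obtain E where E: "E \<in> set Es" "T E r = Some t" using set_ts[OF t] by blast
      have sub: "tree_root t \<noteq> {}" "tree_root t \<subseteq> E" "finite E" using T[OF E(1) r E(2)] Es(1) E(1) by auto
      then have "Min E \<le> Min (tree_root t)" by (intro Min_antimono) auto
      then show ?thesis using sub Es(1) E(1) by (metis finite_subset le_trans)
    qed
    ultimately show "\<forall>E\<in>set (map tree_root (ts r)). finite E \<and> E \<noteq> {} \<and>
        length (map tree_root (ts r)) \<le> Min E"
      by (auto simp del: Min.bounded_iff intro: le_trans)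
    have "set_less (tree_root t) (tree_root t')"
      if E: "E \<in> set Es" "T E r = Some t" and E': "E' \<in> set Es" "T E' r = Some t'" and "set_less E E'"
      for E E' t t'
    proof -
      have "tree_root t \<subseteq> E" "tree_root t' \<subseteq> E'" "finite E" "finite E'"
        using T[OF E(1) r E(2)] T[OF E'(1) r E'(2)] Es(1) E E' by auto
      then show ?thesis
        using \<open>set_less E E'\<close> finite_subset by (auto simp: set_less_iff finite_subset)
    qed
    then have "sorted_wrt set_less (map tree_root (List.map_filter (\<lambda>E. T E r) Fs))"
      if "sorted_wrt set_less Fs" "set Fs \<subseteq> set Es" for Fs
      using that
      by (induction Fs) (fastforce simp: List.map_filter_simps map_filter_def split: option.splits)+
    then show "sorted_wrt set_less (map tree_root (ts r))"
      using Es(2) by (simp add: ts_def)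
  qed
  have val_S: "tree_value ?x l (S r) = (\<Sum>E\<leftarrow>Es. tree_value ?x (Suc l) (T E r))" for r
  proof -
    have "(\<Sum>E\<leftarrow>Fs. tree_value ?x (Suc l) (T E r)) =
        (\<Sum>t\<leftarrow>List.map_filter (\<lambda>E. T E r) Fs. tree_value ?x (Suc l) (Some t))" for Fs
      by (induction Fs) (auto simp: List.map_filter_simps tree_value_def split: option.splits)
    moreover have "tree_value ?x l (Some (Node F ts)) = (\<Sum>t\<leftarrow>ts. tree_value ?x (Suc l) (Some t))"
      if "ts \<noteq> []" for F ts
      using that by (simp add: tree_value_def sum_list_concat_map comp_def)
    ultimately show ?thesis by (simp add: S_def ts_def tree_value_def)
  qed
  have good: "admissible_tree t \<and> tree_root t \<noteq> {} \<and> tree_root t \<subseteq> B \<and>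
      (\<forall>(m, E)\<in>set (terminals l t). m mod n = r)" if r: "r < n" and t: "S r = Some t" for r t
  proof -
    have ne: "ts r \<noteq> []" and t': "t = Node (\<Union>(set (map tree_root (ts r)))) (ts r)"
      using t by (auto simp: S_def split: if_splits)
    have sub: "admissible_tree u \<and> tree_root u \<noteq> {} \<and> tree_root u \<subseteq> B \<and>
        (\<forall>(m, E)\<in>set (terminals (Suc l) u). m mod n = r)" if "u \<in> set (ts r)" for u
      using set_ts[OF that] T r by blast
    then have "tree_root t \<subseteq> B" unfolding t' by auto
    moreover have "tree_root t \<noteq> {}" using sub ne unfolding t' by (cases "ts r") auto
    moreover have "admissible_tree t"
    proof -
      have "finite (tree_root t)" "0 \<notin> tree_root t"
        using \<open>tree_root t \<subseteq> B\<close> step.prems(2,3) by (auto dest: finite_subset)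
      then show ?thesis using sub adm[OF r] unfolding t' by simp
    qed
    moreover have "\<forall>(m, E)\<in>set (terminals l t). m mod n = r"
      using sub ne unfolding t' by fastforce
    ultimately show ?thesis by blast
  qed
  have pair_f: "pair (\<lambda>i. 1/2 * (\<Sum>E\<leftarrow>Es. f E i)) (restr B ?x) =
      1/2 * (\<Sum>E\<leftarrow>Es. pair (f E) (restr (B \<inter> E) ?x))"
  proof -
    have eq: "pair g (restr B ?x) = (\<Sum>i\<in>B. g i * ?x i)" for g
      using step.prems(2) by (subst pair_eq[of B]) (auto simp: restr_def intro!: sum.cong)
    have "pair (f E) (restr (B \<inter> E) ?x) = (\<Sum>i\<in>B. f E i * ?x i)" if "E \<in> set Es" for E
      using step.prems(2) step.hyps(3)[OF that]
      by (subst pair_eq[of B]) (auto simp: restr_def intro!: sum.cong)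
    then have "(\<Sum>E\<leftarrow>Es. pair (f E) (restr (B \<inter> E) ?x)) = (\<Sum>E\<in>set Es. \<Sum>i\<in>B. f E i * ?x i)"
      by (simp add: admissible_sum_list[OF step.hyps(1)])
    also have "\<dots> = (\<Sum>i\<in>B. (\<Sum>E\<leftarrow>Es. f E i) * ?x i)"
      by (simp add: admissible_sum_list[OF step.hyps(1)] sum_distrib_right sum.swap[of _ "set Es"])
    finally show ?thesis by (simp only: eq) (simp add: sum_distrib_left mult.assoc)
  qed
  have "(1/2) ^ l * pair (\<lambda>i. 1/2 * (\<Sum>E\<leftarrow>Es. f E i)) (restr B ?x) =
      (\<Sum>E\<leftarrow>Es. (1/2) ^ Suc l * pair (f E) (restr (B \<inter> E) ?x))"
    unfolding pair_f sum_list_const_mult by simp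
  also have "\<dots> \<le> (\<Sum>E\<leftarrow>Es. \<Sum>r<n. tree_value ?x (Suc l) (T E r))"
    using val by (intro sum_list_mono) auto
  also have "\<dots> = (\<Sum>r<n. tree_value ?x l (S r))"
    unfolding val_S admissible_sum_list[OF step.hyps(1)] by (rule sum.swap)
  finally have le: "(1/2) ^ l * pair (\<lambda>i. 1/2 * (\<Sum>E\<leftarrow>Es. f E i)) (restr B ?x) \<le>
      (\<Sum>r<n. tree_value ?x l (S r))" .
  show ?case
    by (intro exI[of _ S] conjI[OF _ le] allI impI) (rule good)
qed

lemma tree_value_le_tree_norm:
  assumes "admissible_tree t" "\<And>m E. (m, E) \<in> set (terminals 0 t) \<Longrightarrow> \<exists>k. m = j + n * k"
  shows "(\<Sum>(m, E)\<leftarrow>terminals 0 t. (1/2) ^ m * supn (restr E (coord x))) \<le> tree_norm j n x"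
  unfolding tree_norm_def
  by (rule cSUP_upper) (use assms bdd_tree_norm in \<open>auto intro!: bdd_aboveI[of _ "norm x"]\<close>)

lemma supn_restr_nonneg: "finite E \<Longrightarrow> 0 \<le> supn (restr E (coord x))"
  by (simp add: c00_restr_coord supn_nonneg)

lemma tree_norm_nonneg: "0 \<le> tree_norm j n x"
proof -
  obtain t where t: "admissible_tree t" "\<forall>(m, E)\<in>set (terminals 0 t). \<exists>k. m = j + n * k"
    using tree_norm_nonempty[of j n] by blast
  have "finite E" if "admissible_tree t" "(m, E) \<in> set (terminals l t)" for t m E l
    using that by (induction l t rule: terminals.induct) (auto split: if_splits)
  then have "0 \<le> (\<Sum>(m, E)\<leftarrow>terminals 0 t. (1/2) ^ m * supn (restr E (coord x)))"
    using t(1) by (intro sum_list_nonneg) (auto intro!: mult_nonneg_nonneg supn_restr_nonneg)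
  also have "\<dots> \<le> tree_norm j n x"
    by (rule tree_value_le_tree_norm) (use t in auto)
  finally show ?thesis .
qed

text \<open>A norming functional of an initial segment splits into trees with root level 0, and the
  tree of class \<open>r\<close> competes in the supremum \<open>tree_norm r n x\<close>. For an
  absent tree the tree norm is still nonnegative.\<close>

lemma norm_le_sum_tree_norm:
  assumes "1 \<le> n"
  shows "norm x \<le> (\<Sum>j<n. tree_norm j n x)"
proof (rule norm_le_tsirelson)
  fix N
  \<comment> \<open>Nodes of admissible trees avoid 0, where all vectors vanish.\<close>
  have eq: "restr {..N} (coord x) = restr {1..N} (coord x)"
  proof
    fix i show "restr {..N} (coord x) i = restr {1..N} (coord x) i"
      by (cases "i = 0") (auto simp: restr_def)
  qed
  show "tsnorm (restr {..N} (coord x)) \<le> (\<Sum>j<n. tree_norm j n x)"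
    unfolding tsnorm_fnorm
  proof (rule fnorm_le)
    fix f assume f: "f \<in> norming"
    have "\<exists>T. (\<forall>r<n. \<forall>t. T r = Some t \<longrightarrow> admissible_tree t \<and> tree_root t \<noteq> {} \<and>
          tree_root t \<subseteq> {1..N} \<and> (\<forall>(m, E)\<in>set (terminals 0 t). m mod n = r)) \<and>
        (1/2) ^ 0 * pair f (restr {1..N} (coord x)) \<le> (\<Sum>r<n. tree_value (coord x) 0 (T r))"
      by (rule norming_split[OF f assms]) auto
    then obtain T where T0: "\<forall>r<n. \<forall>t. T r = Some t \<longrightarrow> admissible_tree t \<and> tree_root t \<noteq> {} \<and>
        tree_root t \<subseteq> {1..N} \<and> (\<forall>(m, E)\<in>set (terminals 0 t). m mod n = r)"
      and le: "(1/2) ^ 0 * pair f (restr {1..N} (coord x)) \<le> (\<Sum>r<n. tree_value (coord x) 0 (T r))"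
      by (elim exE conjE)
    have T: "admissible_tree t \<and> (\<forall>(m, E)\<in>set (terminals 0 t). m mod n = r)"
      if "r < n" "T r = Some t" for r t
      using T0 that by simp
    have "tree_value (coord x) 0 (T r) \<le> tree_norm r n x" if "r < n" for r
    proof (cases "T r")
      case None
      then show ?thesis by (simp add: tree_value_def tree_norm_nonneg)
    next
      case (Some t)
      have "\<exists>k. m = r + n * k" if "(m, E) \<in> set (terminals 0 t)" for m E
      proof -
        have "m mod n = r" using T[OF \<open>r < n\<close> Some] that by blast
        then have "m = r + n * (m div n)" by (metis mod_mult_div_eq)
        then show ?thesis ..
      qed
      then show ?thesis
        using T[OF that Some] tree_value_le_tree_norm by (simp add: tree_value_def Some)
    qed
    then have "(\<Sum>r<n. tree_value (coord x) 0 (T r)) \<le> (\<Sum>r<n. tree_norm r n x)"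
      by (intro sum_mono) auto
    then show "pair f (restr {..N} (coord x)) \<le> (\<Sum>j<n. tree_norm j n x)"
      using le unfolding eq by simp
  qed (simp add: c00_restr_coord)
qed

section \<open>Stable block subspaces\<close>

lemma coord_sum: "coord (\<Sum>k\<in>F. g k) i = (\<Sum>k\<in>F. coord (g k) i)"
  by (induction F rule: infinite_finite_induct) auto

lemma coord_unit_basis: "coord (unit_basis k) i = (if i = Suc k then 1 else 0)"
  by (simp add: unit_basis_def coord_unit_vec)

text \<open>Successive supports advance by at least one, so
  \<open>k \<le> Min (F k)\<close>.\<close>

lemma block_basis_far:
  assumes "block_basis b y" "\<And>k i. i \<le> k \<Longrightarrow> coord (b k) i = 0" "i \<le> k"
  shows "coord (y k) i = 0"
proof -
  obtain F a where F: "\<And>k. finite (F k) \<and> F k \<noteq> {} \<and> set_less (F k) (F (Suc k)) \<and>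
      y k = (\<Sum>m\<in>F k. a m *\<^sub>R b m)"
    using assms(1) unfolding block_basis_def by blast
  have "k \<le> Min (F k)"
  proof (induction k)
    case (Suc k)
    have "Min (F k) \<le> Max (F k)" using F by simp
    also have "\<dots> < Min (F (Suc k))" using F[of k] F[of "Suc k"] unfolding set_less_def by blast
    finally show ?case using Suc by linarith
  qed simp
  then have "coord (b m) i = 0" if "m \<in> F k" for m
    using F[of k] that assms(2,3) by (meson Min_le le_trans)
  then show ?thesis using F[of k] by (simp add: coord_sum)
qed

text \<open>A normalized late block vector; the upper estimate applies to such vectors.\<close>

lemma block_subspace_of_far:
  assumes "block_subspace_of Z Y"
  shows "\<exists>z\<in>unit_sphere Z. \<forall>i\<le>k. coord z i = 0"
proof -
  obtain y z where y: "block_basis unit_basis y" and z: "block_basis y z" and Z: "Z = closed_span z"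
    using assms unfolding block_subspace_of_def by blast
  have "coord (y k) i = 0" if "i \<le> k" for k i
    by (rule block_basis_far[OF y _ that]) (simp add: coord_unit_basis)
  then have "\<forall>i\<le>k. coord (z k) i = 0"
    using block_basis_far[OF z] by blast
  moreover have "z k \<noteq> 0" using z unfolding block_basis_def by blast
  moreover have "z k /\<^sub>R norm (z k) \<in> Z"
    unfolding Z closed_span_def
    by (rule subsetD[OF closure_subset]) (intro span_scale span_base, simp)
  ultimately show ?thesis
    by (intro bexI[of _ "z k /\<^sub>R norm (z k)"]) (auto simp: unit_sphere_def)
qed

text \<open>Stability at \<open>d\<close> asks for the exact infimum, whereas stabilization provides
  some lower bound \<open>e\<close>. As \<open>e \<le> d\<close>, the upper bound
  \<open>K * e\<close> relaxes to \<open>K * d\<close>.\<close>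

lemma n_stableI:
  assumes "1 \<le> n" "S = unit_sphere Z" "S \<noteq> {}" "1 \<le> K"
    and bounds: "\<And>j z. j < n \<Longrightarrow> z \<in> S \<Longrightarrow> e \<le> tree_norm j n z \<and> tree_norm j n z \<le> K * e"
  defines "d \<equiv> INF j\<in>{..<n}. INF z\<in>S. tree_norm j n z"
  shows "n_stable K n d Z" "e \<le> d" "\<And>j z. j < n \<Longrightarrow> z \<in> S \<Longrightarrow> d \<le> tree_norm j n z"
proof -
  let ?g = "\<lambda>j z. tree_norm j n z"
  have "0 \<in> {..<n}" using assms(1) by simp
  then have ne: "{..<n} \<noteq> {}" by blast
  have inf: "e \<le> (INF z\<in>S. ?g j z)" and sup: "(SUP z\<in>S. ?g j z) \<le> K * e" if "j < n" for j
    using bounds[OF that] assms(3) by (auto intro: cINF_greatest cSUP_least)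
  have bdd: "bdd_below (?g j ` S)" "bdd_above (?g j ` S)" if "j < n" for j
    using bounds[OF that] by (auto intro!: bdd_belowI[of _ e] bdd_aboveI[of _ "K * e"])
  have bddI: "bdd_below ((\<lambda>j. INF z\<in>S. ?g j z) ` {..<n})" and
    bddS: "bdd_above ((\<lambda>j. SUP z\<in>S. ?g j z) ` {..<n})"
    by auto
  show ed: "e \<le> d" unfolding d_def by (rule cINF_greatest[OF ne]) (simp add: inf)
  show le: "d \<le> ?g j z" if "j < n" "z \<in> S" for j z
  proof -
    have "d \<le> (INF z\<in>S. ?g j z)" unfolding d_def by (rule cINF_lower[OF bddI]) (simp add: that)
    also have "\<dots> \<le> ?g j z" by (rule cINF_lower[OF bdd(1)]) (use that in auto)
    finally show ?thesis .
  qed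
  have "(SUP j\<in>{..<n}. SUP z\<in>S. ?g j z) \<le> K * e"
    by (rule cSUP_least[OF ne]) (simp add: sup)
  also have "\<dots> \<le> K * d" using ed assms(4) by (intro mult_left_mono) auto
  finally have up: "(SUP j\<in>{..<n}. SUP z\<in>S. ?g j z) \<le> K * d" .
  obtain z where z: "z \<in> S" using assms(3) by blast
  have "d \<le> ?g 0 z" using le assms(1) z by simp
  also have "\<dots> \<le> (SUP z\<in>S. ?g 0 z)" by (rule cSUP_upper[OF z]) (use bdd assms(1) in simp)
  also have "\<dots> \<le> (SUP j\<in>{..<n}. SUP z\<in>S. ?g j z)"
    by (rule cSUP_upper[OF _ bddS]) (use assms(1) in simp)
  finally show "n_stable K n d Z"
    unfolding n_stable_def using up by (simp add: d_def assms(2))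
qed

text \<open>At a unit vector supported far out, \<open>n\<close> trees of value at least
  \<open>d / 2\<close>, one for each residue class, add up to at most 8.\<close>

lemma tree_norm_lower_bound_le:
  assumes n: "1 \<le> n" and d: "0 < d" and Z: "block_subspace_of Z Y"
    and le: "\<And>j z. j < n \<Longrightarrow> z \<in> unit_sphere Z \<Longrightarrow> d \<le> tree_norm j n z"
  shows "real n * d \<le> 16"
proof -
  obtain z where z: "z \<in> unit_sphere Z" and far: "\<And>i. i \<le> n + 2 \<Longrightarrow> coord z i = 0"
    using block_subspace_of_far[OF Z] by blast
  let ?v = "\<lambda>t. \<Sum>(m, E)\<leftarrow>terminals 0 t. (1/2) ^ m * supn (restr E (coord z))"
  \<comment> \<open>Half of \<open>d\<close>, since the supremum in \<open>tree_norm\<close> may not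
    be attained.\<close>
  let ?P = "\<lambda>j t. admissible_tree t \<and> (\<forall>(m, E)\<in>set (terminals 0 t). \<exists>k. m = j + n * k) \<and>
      d / 2 \<le> ?v t"
  have "\<exists>t. ?P j t" if "j < n" for j
  proof (rule ccontr)
    assume *: "\<not> ?thesis"
    have "tree_norm j n z \<le> d / 2"
      unfolding tree_norm_def
      by (rule cSUP_least[OF tree_norm_nonempty]) (use * in \<open>auto simp: not_le intro: less_imp_le\<close>)
    then show False using le[OF that z] d by linarith
  qed
  then have "\<forall>j\<in>{..<n}. \<exists>t. ?P j t" by simp
  then obtain t where P: "\<forall>j\<in>{..<n}. ?P j (t j)"
    by (rule bchoice[THEN exE])
  then have t: "admissible_tree (t j)" "\<forall>(m, E)\<in>set (terminals 0 (t j)). \<exists>k. m = j + n * k"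
    "d / 2 \<le> ?v (t j)" if "j < n" for j
    using that by simp_all
  have "real n * (d / 2) = (\<Sum>j<n. d / 2)" by simp
  also have "\<dots> \<le> (\<Sum>j<n. ?v (t j))" using t(3) by (intro sum_mono) auto
  also have "\<dots> \<le> 8 * norm z"
    by (rule sum_trees_le) (use t(1,2) far in fastforce)+
  also have "norm z = 1" using z by (simp add: unit_sphere_def)
  finally show ?thesis by simp
qed

theorem corollary3p6:
  fixes K :: real
  assumes "stabilizing_constant K"
  shows "\<exists>C>0. \<forall>(Y :: tsirelson set) (n :: nat). block_subspace Y \<longrightarrow> 1 \<le> n \<longrightarrow>
           (\<exists>Z d. block_subspace_of Z Y \<and> 0 < d \<and> n_stable K n d Z \<and>
              inverse (C * real n) \<le> d \<and> d \<le> C * inverse (real n))"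
\<comment> \<open>The two estimates give \<open>1 \<le> K * n * e\<close> with
  \<open>e \<le> d\<close>, and \<open>n * d \<le> 16\<close>; \<open>K + 16\<close> serves
  both.\<close>
proof (intro exI[of _ "K + 16"] conjI allI impI)
  have K: "1 < K" using assms by (simp add: stabilizing_constant_def)
  then show "0 < K + 16" by simp
  fix Y :: "tsirelson set" and n :: nat
  assume Y: "block_subspace Y" and n: "1 \<le> n"
  obtain Z e where Z: "block_subspace_of Z Y" and e: "0 < e"
    and bounds: "\<And>j z. j < n \<Longrightarrow> z \<in> unit_sphere Z \<Longrightarrow> e \<le> tree_norm j n z \<and> tree_norm j n z \<le> K * e"
    using assms Y n unfolding stabilizing_constant_def by metis
  obtain z where z: "z \<in> unit_sphere Z" using block_subspace_of_far[OF Z] by blast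
  define d where "d = (INF j\<in>{..<n}. INF z\<in>unit_sphere Z. tree_norm j n z)"
  have ne: "unit_sphere Z \<noteq> {}" using z by blast
  have d: "n_stable K n d Z" "e \<le> d" "\<And>j z. j < n \<Longrightarrow> z \<in> unit_sphere Z \<Longrightarrow> d \<le> tree_norm j n z"
    unfolding d_def using n_stableI[OF n refl ne _ bounds] K by simp_all
  have "1 \<le> (\<Sum>j<n. tree_norm j n z)"
    using norm_le_sum_tree_norm[OF n, of z] z by (simp add: unit_sphere_def)
  also have "\<dots> \<le> (\<Sum>j<n. K * e)" using bounds z by (intro sum_mono) auto
  also have "\<dots> = K * real n * e" by simp
  also have "\<dots> \<le> (K + 16) * real n * d"
    using d(2) e K by (intro mult_mono) auto
  finally have "1 \<le> (K + 16) * real n * d" .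
  then have "inverse ((K + 16) * real n) \<le> d"
    using n K by (simp add: inverse_eq_divide pos_divide_le_eq mult.commute)
  moreover have "real n * d \<le> 16"
    by (rule tree_norm_lower_bound_le[OF n _ Z d(3)]) (use d(2) e in auto)
  then have "real n * d \<le> K + 16" using K by linarith
  then have "d \<le> (K + 16) * inverse (real n)"
    using n by (simp add: field_simps)
  ultimately show "\<exists>Z d. block_subspace_of Z Y \<and> 0 < d \<and> n_stable K n d Z \<and>
      inverse ((K + 16) * real n) \<le> d \<and> d \<le> (K + 16) * inverse (real n)"
    using Z d(1,2) e by (intro exI[of _ Z] exI[of _ d]) auto
qed

end
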